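(* Consider the problem of approximating the optimal $2$-Single-Linkage Clustering objective value of an input set of $n$ vectors in $\mathbb R^d$ in the MPC model with $s=n^{\alpha}$ for a constant $\alpha<1$. Then, for every constant $\epsilon>0$: (1) Assuming the One-Cycle-vs-Two-Cycles Conjecture, no $o(\log n)$-round MPC algorithm achieves approximation better than $\sqrt{2+\sqrt2}-\epsilon$ under the $\ell_2$ distance for $d=\Omega(\log n/\epsilon^2)$. (2) Assuming the One-Cycle-vs-Two-Cycles Conjecture, no $o(\log n)$-round MPC algorithm achieves approximation better than $3$ under the $\ell_1$ distance, even for $O(1)$-sparse vectors, for $d=\Omega(n)$. (3) Assuming the Sparse Connectivity Conjecture, no $o(\log n)$-round MPC algorithm achieves approximation better than $\sqrt2-\epsilon$ under the $\ell_2$ distance for $d=\Omega(\log n/\epsilon^2)$. (4) Assuming the Sparse Connectivity Conjecture, no $o(\log n)$-round MPC algorithm achieves approximation better than $2$ under the $\ell_1$ distance, even for $O(1)$-sparse vectors, for $d=\Omega(n)$.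
   Context: The $2$-Single-Linkage Clustering objective value of vectors $v_1,\dots,v_n$ under a distance $\rho$ is $\max$ over partitions $(C_1,C_2)$ into two nonempty parts of $\min_{a\in C_1,b\in C_2}\rho(a,b)$; an algorithm achieves approximation $\beta$ if it outputs a value within a multiplicative factor $\beta$ of this optimum. A vector is $O(1)$-sparse if it has $O(1)$ non-zero coordinates. Massively Parallel Computation (MPC) model: there are $m$ machines with local memory $s$ each, with $m\cdot s=\tilde O(N)$ for input size $N$; computation proceeds in synchronous rounds, in each of which every machine performs local computation on its data (within space $s$) and then sends and receives messages of total size at most $s$, delivered before the next round. Sparse Connectivity Conjecture: if $s=n^{\alpha}$ for a constant $\alpha<1$, solving connectivity on an input graph with $n$ vertices and $O(n)$ edges requires $\Omega(\log n)$ MPC rounds. One-Cycle-vs-Two-Cycles Conjecture: if $s=n^{\alpha}$ for a constant $\alpha<1$, distinguishing a single cycle on $n$ vertices from two disjoint cycles on $n/2$ vertices each requires $\Omega(\log n)$ MPC rounds. *)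

theory Defs
  imports "HOL-Analysis.Analysis" "HOL-Library.Landau_Symbols"
begin

text \<open>The relation \<open>f = O~(g)\<close>: an upper bound up to polylogarithmic factors.\<close>

definition soft_O :: "(nat \<Rightarrow> real) \<Rightarrow> (nat \<Rightarrow> real) \<Rightarrow> bool" where
  "soft_O f g \<longleftrightarrow> (\<exists>p::nat. f \<in> O(\<lambda>n. g n * ln (real n) ^ p))"


section \<open>Massively parallel computation\<close>

text \<open>
  Memory contents and messages are lists of machine words, a word being a bounded integer (see
  \<open>within_limits\<close>).  In round \<open>t\<close>, machine \<open>i\<close> with memory \<open>x\<close> performs an arbitrary local
  computation, which determines the data \<open>keep t i x\<close> it retains and the message \<open>send t i x j\<close>
  for each machine \<open>j\<close>.  The output is read off the final memory of machine \<open>0\<close>.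
  A program may depend on the size parameter \<open>n\<close>: an algorithm is a family of programs.
\<close>

record 'o mpc =
  machines :: nat
  rounds :: nat
  keep :: "nat \<Rightarrow> nat \<Rightarrow> int list \<Rightarrow> int list"
  send :: "nat \<Rightarrow> nat \<Rightarrow> int list \<Rightarrow> nat \<Rightarrow> int list"
  result :: "int list \<Rightarrow> 'o"

primrec memory :: "'o mpc \<Rightarrow> (nat \<Rightarrow> int list) \<Rightarrow> nat \<Rightarrow> nat \<Rightarrow> int list" where
  "memory A M 0 j = M j"
| "memory A M (Suc t) j =
     keep A t j (memory A M t j) @
     concat (map (\<lambda>i. send A t i (memory A M t i) j) [0..<machines A])"

text \<open>
  Every machine has at most \<open>s\<close> words in memory at all times, each of absolute value at most \<open>W\<close>,
  and in every round sends and receives at most \<open>s\<close> words.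
\<close>

definition within_limits :: "'o mpc \<Rightarrow> nat \<Rightarrow> nat \<Rightarrow> (nat \<Rightarrow> int list) \<Rightarrow> bool" where
  "within_limits A s W M \<longleftrightarrow>
     (\<forall>t \<le> rounds A. \<forall>j < machines A.
        length (memory A M t j) \<le> s \<and> (\<forall>x \<in> set (memory A M t j). \<bar>x\<bar> \<le> int W)) \<and>
     (\<forall>t < rounds A. \<forall>i < machines A.
        (\<Sum>j<machines A. length (send A t i (memory A M t i) j)) \<le> s \<and>
        (\<Sum>j<machines A. length (send A t j (memory A M t j) i)) \<le> s)"

text \<open>
  The items of the input \<open>X\<close> are initially distributed over the \<open>m\<close> machines in an arbitrary, but
  balanced way; \<open>N\<close> is the (maximal) input size.  As the memory limit applies from time \<open>0\<close> on, a
  program with too few machines to hold the input violates \<open>within_limits\<close>.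
\<close>

definition distributes :: "nat \<Rightarrow> nat \<Rightarrow> 'a set \<Rightarrow> (nat \<Rightarrow> 'a list) \<Rightarrow> bool" where
  "distributes m N X D \<longleftrightarrow>
     distinct (concat (map D [0..<m])) \<and> set (concat (map D [0..<m])) = X \<and>
     (\<forall>i<m. length (D i) \<le> nat \<lceil>real N / real m\<rceil>)"

definition correct_on ::
  "'o mpc \<Rightarrow> nat \<Rightarrow> nat \<Rightarrow> nat \<Rightarrow> ('a \<Rightarrow> int list) \<Rightarrow> 'a set \<Rightarrow> 'o set \<Rightarrow> bool" where
  "correct_on A s W N enc X Y \<longleftrightarrow>
     (\<forall>D. distributes (machines A) N X D \<longrightarrow>
        (let M = (\<lambda>i. concat (map enc (D i)))
         in within_limits A s W M \<and> result A (memory A M (rounds A) 0) \<in> Y))"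

text \<open>For each \<open>n\<close>, the pairs of a possible input and the set of its admissible outputs.\<close>

type_synonym ('a, 'o) problem = "nat \<Rightarrow> ('a set \<times> 'o set) set"

text \<open>
  The family \<open>A\<close> solves \<open>P\<close> with local memory \<open>s = \<Theta>(n\<^sup>\<alpha>)\<close>, measured in words of \<open>O(log n)\<close> bits,
  and total memory \<open>m \<cdot> s = O~(N)\<close>.
\<close>

definition mpc_algorithm ::
  "real \<Rightarrow> (nat \<Rightarrow> nat) \<Rightarrow> ('a \<Rightarrow> int list) \<Rightarrow> ('a, 'o) problem \<Rightarrow> (nat \<Rightarrow> 'o mpc) \<Rightarrow> bool" where
  "mpc_algorithm \<alpha> N enc P A \<longleftrightarrow>
     (\<exists>s::nat \<Rightarrow> nat. \<exists>c::nat.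
        (\<lambda>n. real (s n)) \<in> \<Theta>(\<lambda>n. real n powr \<alpha>) \<and>
        soft_O (\<lambda>n. real (machines (A n) * s n)) (\<lambda>n. real (N n)) \<and>
        (\<forall>\<^sub>F n in sequentially. 0 < machines (A n) \<and>
           (\<forall>(X, Y) \<in> P n. correct_on (A n) (s n) (n ^ c) (N n) enc X Y)))"


section \<open>Graph problems and conjectures\<close>

text \<open>
  A simple graph on the vertices \<open>0, \<dots>, n - 1\<close> is given by its set of edges \<open>(u, v)\<close>, where
  \<open>u < v < n\<close>.
\<close>

definition enc_edge :: "nat \<times> nat \<Rightarrow> int list" where
  "enc_edge e = [int (fst e), int (snd e)]"

definition cycle_edges :: "nat list \<Rightarrow> (nat \<times> nat) set" where
  "cycle_edges p =
     {(min u v, max u v) | u v. \<exists>i < length p. u = p ! i \<and> v = p ! (Suc i mod length p)}"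

definition is_cycle :: "nat set \<Rightarrow> (nat \<times> nat) set \<Rightarrow> bool" where
  "is_cycle V E \<longleftrightarrow>
     (\<exists>p. distinct p \<and> 3 \<le> length p \<and> set p = V \<and> E = cycle_edges p)"

definition two_cycles :: "nat \<Rightarrow> (nat \<times> nat) set \<Rightarrow> bool" where
  "two_cycles n E \<longleftrightarrow>
     (\<exists>V1 V2 E1 E2. V1 \<union> V2 = {..<n} \<and> V1 \<inter> V2 = {} \<and> card V1 = card V2 \<and>
        is_cycle V1 E1 \<and> is_cycle V2 E2 \<and> E = E1 \<union> E2)"

definition cycle_problem :: "(nat \<times> nat, bool) problem" where
  "cycle_problem n =
     (if even n
      then {(E, {True}) | E. is_cycle {..<n} E} \<union> {(E, {False}) | E. two_cycles n E}
      else {})"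

text \<open>The number \<open>n = 2k\<close> of vertices is even in this problem, so the bound is along even \<open>n\<close>.\<close>

definition one_cycle_vs_two_cycles_conjecture :: bool where
  "one_cycle_vs_two_cycles_conjecture \<longleftrightarrow>
     (\<forall>\<alpha> \<in> {0<..<1}. \<forall>A. mpc_algorithm \<alpha> (\<lambda>n. n) enc_edge cycle_problem A \<longrightarrow>
        (\<lambda>k. real (rounds (A (2 * k)))) \<in> \<Omega>(\<lambda>k. ln (real (2 * k))))"

definition connected_graph :: "nat \<Rightarrow> (nat \<times> nat) set \<Rightarrow> bool" where
  "connected_graph n E \<longleftrightarrow> (\<forall>u<n. \<forall>v<n. (u, v) \<in> (E \<union> E\<inverse>)\<^sup>*)"

definition connectivity_problem :: "nat \<Rightarrow> (nat \<times> nat, bool) problem" where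
  "connectivity_problem C n =
     {(E, {connected_graph n E}) | E. E \<subseteq> {(u, v). u < v \<and> v < n} \<and> card E \<le> C * n}"

definition sparse_connectivity_conjecture :: bool where
  "sparse_connectivity_conjecture \<longleftrightarrow>
     (\<exists>C \<ge> 1. \<forall>\<alpha> \<in> {0<..<1}. \<forall>A.
        mpc_algorithm \<alpha> (\<lambda>n. C * n) enc_edge (connectivity_problem C) A \<longrightarrow>
        (\<lambda>n. real (rounds (A n))) \<in> \<Omega>(\<lambda>n. ln (real n)))"


section \<open>2-Single-Linkage Clustering\<close>

text \<open>A vector of \<open>\<real>\<^sup>d\<close> is a function that vanishes outside \<open>{..<d}\<close>.\<close>

type_synonym rvec = "nat \<Rightarrow> real"

definition l1_dist :: "nat \<Rightarrow> rvec \<Rightarrow> rvec \<Rightarrow> real" where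
  "l1_dist d x y = (\<Sum>j<d. \<bar>x j - y j\<bar>)"

definition l2_dist :: "nat \<Rightarrow> rvec \<Rightarrow> rvec \<Rightarrow> real" where
  "l2_dist d x y = L2_set (\<lambda>j. x j - y j) {..<d}"

definition slc2 :: "(rvec \<Rightarrow> rvec \<Rightarrow> real) \<Rightarrow> rvec set \<Rightarrow> real" where
  "slc2 \<rho> V =
     Max {Min {\<rho> a b | a b. a \<in> C1 \<and> b \<in> C2} | C1 C2.
            C1 \<noteq> {} \<and> C2 \<noteq> {} \<and> C1 \<inter> C2 = {} \<and> C1 \<union> C2 = V}"

text \<open>
  For a maximization problem, a value within a factor \<open>\<beta>\<close> of the optimum lies between
  \<open>opt / \<beta>\<close> and \<open>opt\<close>.
\<close>

definition approximations :: "real \<Rightarrow> real \<Rightarrow> real set" where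
  "approximations \<beta> opt = {x. x \<le> opt \<and> opt \<le> \<beta> * x}"

text \<open>
  Inputs consist of machine words, hence the coordinates of input vectors are rational numbers
  with numerator and denominator of \<open>O(log n)\<close> bits (bounded by \<open>n\<^sup>b\<close>).  The instance consists of
  \<open>n\<close> distinct \<open>k\<close>-sparse vectors \<open>v 0, \<dots>, v (n - 1)\<close> in dimension \<open>d\<close>, presented by their
  non-zero coordinates; \<open>k = d\<close> means that there is no restriction on the sparsity.
\<close>

definition slc_instance :: "nat \<Rightarrow> nat \<Rightarrow> nat \<Rightarrow> nat \<Rightarrow> (nat \<Rightarrow> nat \<Rightarrow> rat) \<Rightarrow> bool" where
  "slc_instance b d k n v \<longleftrightarrow>
     inj_on v {..<n} \<and>
     (\<forall>i<n. (\<forall>j\<ge>d. v i j = 0) \<and> card {j. v i j \<noteq> 0} \<le> k \<and>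
        (\<forall>j. \<bar>fst (quotient_of (v i j))\<bar> \<le> int (n ^ b) \<and>
             snd (quotient_of (v i j)) \<le> int (n ^ b)))"

definition entries :: "nat \<Rightarrow> (nat \<Rightarrow> nat \<Rightarrow> rat) \<Rightarrow> (nat \<times> nat \<times> rat) set" where
  "entries n v = {(i, j, v i j) | i j. i < n \<and> v i j \<noteq> 0}"

definition enc_entry :: "nat \<times> nat \<times> rat \<Rightarrow> int list" where
  "enc_entry = (\<lambda>(i, j, x). [int i, int j, fst (quotient_of x), snd (quotient_of x)])"

definition slc_problem ::
  "(nat \<Rightarrow> rvec \<Rightarrow> rvec \<Rightarrow> real) \<Rightarrow> (nat \<Rightarrow> real) \<Rightarrow> nat \<Rightarrow> (nat \<Rightarrow> nat) \<Rightarrow> (nat \<Rightarrow> nat) \<Rightarrow>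
   (nat \<times> nat \<times> rat, real) problem" where
  "slc_problem \<rho> \<beta> b d k n =
     {(entries n v,
       approximations (\<beta> n) (slc2 (\<rho> (d n)) ((\<lambda>i j. real_of_rat (v i j)) ` {..<n}))) | v.
      slc_instance b (d n) (k n) n v}"

text \<open>
  No MPC algorithm with local memory \<open>n\<^sup>\<alpha>\<close> and \<open>o(log n)\<close> rounds achieves an approximation better
  than \<open>\<gamma>\<close> on \<open>n\<close> vectors in dimension \<open>d n\<close>, each with at most \<open>k n\<close> non-zero coordinates; the
  input size is \<open>N = n \<cdot> k n\<close>.
\<close>

definition no_fast_slc_approximation ::
  "real \<Rightarrow> (nat \<Rightarrow> rvec \<Rightarrow> rvec \<Rightarrow> real) \<Rightarrow> real \<Rightarrow> (nat \<Rightarrow> nat) \<Rightarrow> (nat \<Rightarrow> nat) \<Rightarrow> bool" where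
  "no_fast_slc_approximation \<alpha> \<rho> \<gamma> d k \<longleftrightarrow>
     \<not> (\<exists>A \<beta> b. (\<forall>n. 1 \<le> \<beta> n \<and> \<beta> n < \<gamma>) \<and> 1 \<le> b \<and>
          mpc_algorithm \<alpha> (\<lambda>n. n * k n) enc_entry (slc_problem \<rho> \<beta> b d k) A \<and>
          (\<lambda>n. real (rounds (A n))) \<in> o(\<lambda>n. ln (real n)))"

end

theory Submission
  imports Defs "HOL-Real_Asymp.Real_Asymp"
begin

text \<open>
  Given (nearly) orthogonal integer vectors \<open>a\<^sub>u\<close> of equal length, map each vertex \<open>u\<close> of a graph to
  \<open>3a\<^sub>u\<close> and each edge \<open>{u, v}\<close> to the two points \<open>2a\<^sub>u + a\<^sub>v\<close> and \<open>a\<^sub>u + 2a\<^sub>v\<close> on the segment between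
  \<open>3a\<^sub>u\<close> and \<open>3a\<^sub>v\<close>.  Along a path of the graph one walks in steps of length at most \<open>\<theta> \<approx> \<parallel>a\<^sub>u - a\<^sub>v\<parallel>\<close>, whereas
  points from different components are combinations of disjoint sets of nearly orthogonal vectors,
  hence far apart: at distance \<open>3\<theta>\<close> for \<open>\<ell>\<^sub>1\<close> and the unit vectors, and at distance at least
  \<open>\<surd>(7/2) \<theta>\<close> for \<open>\<ell>\<^sub>2\<close> and random sign vectors of dimension \<open>O(log n)\<close>; note \<open>2 + \<surd>2 < 7/2\<close>.  So any
  better approximation of the clustering value tells whether the graph is connected.  Every machine
  computes the points of its own edges, so the reduction costs one round.

  The clustering instance has exactly \<open>n' = (2C + 3)n\<close> points.  Each machine has a fixed set of edge
  slots, and a slot without an edge is filled with the points of a dummy edge from vertex \<open>0\<close> to a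
  new vertex, which does not change the components.  The cycle problem is a special case
  of connectivity, so the same reduction serves both conjectures.
\<close>

section \<open>Nearly orthogonal sign vectors\<close>

definition sign_vectors :: "nat \<Rightarrow> (nat \<Rightarrow> int) set" where
  "sign_vectors K = {..<K} \<rightarrow>\<^sub>E {-1, 1}"

lemma finite_sign_vectors: "finite (sign_vectors K)"
  unfolding sign_vectors_def by (intro finite_PiE) auto

lemma card_sign_vectors: "card (sign_vectors K) = 2 ^ K"
  unfolding sign_vectors_def by (simp add: card_PiE numeral_2_eq_2)

text \<open>
  The moment generating function bound of a Chernoff estimate at \<open>\<lambda> = 1/24\<close>: it beats the threshold
  \<open>K/12\<close> on correlations because \<open>\<lambda>\<^sup>2 < \<lambda>/12\<close>.
\<close>

lemma exp_plus_exp_minus_le: "exp (1/24::real) + exp (-1/24) \<le> 2 * exp (1/576)"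
proof -
  have "exp (1/24::real) \<le> 1 + 1/24 + (1/24)\<^sup>2"
    by (rule exp_bound) auto
  moreover have "25/24 \<le> exp (1/24::real)"
    using exp_ge_add_one_self[of "1/24::real"] by simp
  then have "exp (-1/24::real) \<le> 24/25"
    by (simp add: exp_minus field_simps)
  moreover have "1 + 1/576 \<le> exp (1/576::real)"
    using exp_ge_add_one_self[of "1/576::real"] by simp
  \<comment> \<open>After inserting the three estimates the two sides are 28849/14400 and
    28850/14400, so coarser bounds would not do.\<close>
  ultimately show ?thesis
    by (simp add: power2_eq_square)
qed

text \<open>Exponential Markov inequality in counting form: every bad \<open>b\<close> contributes
  at least exp((K/12)/24) = exp(K/288) to the sum over all sign vectors of exp(correlation/24). That
  sum factors over the coordinates and is at most 2^K * exp(K/576).\<close>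

lemma card_correlated_sign_vectors_le:
  assumes a: "\<And>j. j < K \<Longrightarrow> a j \<in> {-1, 1}"
  shows "real (card {b \<in> sign_vectors K. int K < 12 * (\<Sum>j<K. a j * b j)})
           \<le> 2 ^ K * exp (- real K / 576)"
proof -
  let ?B = "sign_vectors K"
  let ?bad = "{b \<in> ?B. int K < 12 * (\<Sum>j<K. a j * b j)}"
  have "real (card ?bad) * exp (real K / 288) = (\<Sum>b\<in>?bad. exp (real K / 288))"
    by simp
  also have "\<dots> \<le> (\<Sum>b\<in>?bad. exp (of_int (\<Sum>j<K. a j * b j) / 24))"
  proof (rule sum_mono)
    fix b assume "b \<in> ?bad"
    then have "real_of_int (int K) < real_of_int (12 * (\<Sum>j<K. a j * b j))"
      unfolding of_int_less_iff by simp
    then show "exp (real K / 288) \<le> exp (of_int (\<Sum>j<K. a j * b j) / 24 :: real)"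
      by simp
  qed
  also have "\<dots> \<le> (\<Sum>b\<in>?B. exp (of_int (\<Sum>j<K. a j * b j) / 24))"
    by (rule sum_mono2) (auto simp: finite_sign_vectors)
  also have "\<dots> = (\<Sum>b\<in>?B. \<Prod>j<K. exp (of_int (a j * b j) / 24))"
    by (simp add: sum_divide_distrib exp_sum)
  also have "\<dots> = (\<Prod>j<K. \<Sum>c\<in>{-1, 1}. exp (of_int (a j * c) / 24))"
    unfolding sign_vectors_def by (subst prod_sum_PiE) auto
  also have "\<dots> = (\<Prod>j<K. exp (1/24) + exp (-1/24))"
  proof (rule prod.cong)
    fix j assume "j \<in> {..<K}"
    then have "a j = -1 \<or> a j = 1" using a by auto
    then show "(\<Sum>c\<in>{-1, 1}. exp (of_int (a j * c) / 24)) = exp (1/24) + exp (-1/24::real)"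
      by auto
  qed simp
  also have "\<dots> = (exp (1/24) + exp (-1/24)) ^ K"
    by simp
  also have "\<dots> \<le> (2 * exp (1/576)) ^ K"
    by (intro power_mono exp_plus_exp_minus_le) (simp add: add_nonneg_nonneg)
  also have "\<dots> = 2 ^ K * exp (real K / 576)"
    by (simp add: power_mult_distrib flip: exp_of_nat_mult)
  finally have "real (card ?bad) * exp (real K / 288) \<le> 2 ^ K * exp (real K / 576)" .
  then have "real (card ?bad) \<le> 2 ^ K * exp (real K / 576) / exp (real K / 288)"
    by (simp add: field_simps)
  also have "\<dots> = 2 ^ K * exp (- real K / 576)"
    by (simp add: field_simps flip: exp_add)
  finally show ?thesis .
qed

lemma card_abs_correlated_sign_vectors_le:
  assumes a: "\<And>j. j < K \<Longrightarrow> a j \<in> {-1, 1}"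
  shows "real (card {b \<in> sign_vectors K. int K < 12 * \<bar>\<Sum>j<K. a j * b j\<bar>})
           \<le> 2 ^ K * (2 * exp (- real K / 576))"
proof -
  let ?bad = "\<lambda>a. {b \<in> sign_vectors K. int K < 12 * (\<Sum>j<K. a j * b j)}"
  have "{b \<in> sign_vectors K. int K < 12 * \<bar>\<Sum>j<K. a j * b j\<bar>} \<subseteq> ?bad a \<union> ?bad (\<lambda>j. - a j)"
    by (auto simp: sum_negf abs_if split: if_splits)
  then have "card {b \<in> sign_vectors K. int K < 12 * \<bar>\<Sum>j<K. a j * b j\<bar>}
      \<le> card (?bad a \<union> ?bad (\<lambda>j. - a j))"
    by (rule card_mono[rotated]) (auto simp: finite_sign_vectors)
  also have "\<dots> \<le> card (?bad a) + card (?bad (\<lambda>j. - a j))"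
    by (rule card_Un_le)
  finally have "real (card {b \<in> sign_vectors K. int K < 12 * \<bar>\<Sum>j<K. a j * b j\<bar>})
      \<le> real (card (?bad a)) + real (card (?bad (\<lambda>j. - a j)))"
    by linarith
  also have "\<dots> \<le> 2 ^ K * exp (- real K / 576) + 2 ^ K * exp (- real K / 576)"
    by (intro add_mono card_correlated_sign_vectors_le) (use a in auto)
  finally show ?thesis by simp
qed

text \<open>Greedy choice with a union bound: the vectors too correlated with one of the
  \<open>M\<close> chosen ones number fewer than 2^K, so some sign vector is left to extend the
  family.\<close>

lemma ex_nearly_orthogonal_sign_vectors:
  assumes "real M * (2 * exp (- real K / 576)) < 1"
  shows "\<exists>a :: nat \<Rightarrow> nat \<Rightarrow> int. (\<forall>x<M. a x \<in> sign_vectors K) \<and>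
           (\<forall>x<M. \<forall>y<M. x \<noteq> y \<longrightarrow> 12 * \<bar>\<Sum>j<K. a x j * a y j\<bar> \<le> int K)"
  using assms
proof (induction M)
  case (Suc M)
  have "real M * (2 * exp (- real K / 576)) \<le> real (Suc M) * (2 * exp (- real K / 576))"
    by (intro mult_right_mono) auto
  with Suc.prems have M: "real M * (2 * exp (- real K / 576)) < 1"
    by linarith
  then obtain a :: "nat \<Rightarrow> nat \<Rightarrow> int" where a: "\<And>x. x < M \<Longrightarrow> a x \<in> sign_vectors K"
    and orth: "\<And>x y. x < M \<Longrightarrow> y < M \<Longrightarrow> x \<noteq> y \<Longrightarrow> 12 * \<bar>\<Sum>j<K. a x j * a y j\<bar> \<le> int K"
    using Suc.IH by blast
  let ?bad = "\<lambda>x. {b \<in> sign_vectors K. int K < 12 * \<bar>\<Sum>j<K. a x j * b j\<bar>}"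
  have "real (card (\<Union>x<M. ?bad x)) \<le> real (\<Sum>x<M. card (?bad x))"
    unfolding of_nat_le_iff by (rule card_UN_le) simp
  also have "\<dots> = (\<Sum>x<M. real (card (?bad x)))" by simp
  also have "\<dots> \<le> (\<Sum>x<M. 2 ^ K * (2 * exp (- real K / 576)))"
    by (intro sum_mono card_abs_correlated_sign_vectors_le)
       (use a in \<open>auto simp: sign_vectors_def\<close>)
  also have "\<dots> = 2 ^ K * (real M * (2 * exp (- real K / 576)))"
    by simp
  also have "\<dots> < 2 ^ K * 1"
    using M by (intro mult_strict_left_mono) auto
  also have "\<dots> = real (card (sign_vectors K))"
    by (simp add: card_sign_vectors)
  finally have "card (\<Union>x<M. ?bad x) < card (sign_vectors K)"
    by simp
  then have "\<not> sign_vectors K \<subseteq> (\<Union>x<M. ?bad x)"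
    using card_mono[of "\<Union>x<M. ?bad x" "sign_vectors K"] finite_sign_vectors by fastforce
  then obtain b where b: "b \<in> sign_vectors K"
    and new: "\<And>x. x < M \<Longrightarrow> 12 * \<bar>\<Sum>j<K. a x j * b j\<bar> \<le> int K"
    by force
  have "\<forall>x<Suc M. (a(M := b)) x \<in> sign_vectors K"
    using a b by (auto simp: less_Suc_eq)
  moreover have "\<forall>x<Suc M. \<forall>y<Suc M. x \<noteq> y \<longrightarrow>
      12 * \<bar>\<Sum>j<K. (a(M := b)) x j * (a(M := b)) y j\<bar> \<le> int K"
    using orth new by (auto simp: less_Suc_eq mult.commute[of "b _"])
  ultimately show ?case by blast
qed auto

section \<open>Gadgets\<close>

text \<open>The diagonal pair \<open>(x, x)\<close> gives \<open>3 * a x\<close>, so vertices and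
  edge points share one format, and swapping a pair leads to the other point of the same
  edge.\<close>

definition pair_vec :: "(nat \<Rightarrow> nat \<Rightarrow> int) \<Rightarrow> nat \<times> nat \<Rightarrow> nat \<Rightarrow> int" where
  "pair_vec a p j = 2 * a (fst p) j + a (snd p) j"

definition real_vec :: "(nat \<Rightarrow> int) \<Rightarrow> rvec" where
  "real_vec f j = real_of_int (f j)"

text \<open>
  The factor \<open>2\<close> in the sparsity bound leaves room for the uneven distribution of the points: the
  balance condition of \<^const>\<open>distributes\<close> refers to the maximal input size \<open>n \<cdot> k\<close>.
\<close>

definition gadget ::
  "(rvec \<Rightarrow> rvec \<Rightarrow> real) \<Rightarrow> nat \<Rightarrow> nat \<Rightarrow> nat \<Rightarrow> real \<Rightarrow> real \<Rightarrow> (nat \<Rightarrow> nat \<Rightarrow> int) \<Rightarrow> bool" where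
  "gadget \<rho> d k M \<gamma> \<theta> a \<longleftrightarrow> 0 < \<theta> \<and> (\<forall>f g. \<rho> f g = \<rho> g f) \<and>
     (\<forall>x<M. \<forall>y<M.
        (\<forall>j\<ge>d. pair_vec a (x, y) j = 0) \<and>
        (\<forall>j. \<bar>pair_vec a (x, y) j\<bar> \<le> 3) \<and>
        (\<exists>j. pair_vec a (x, y) j \<noteq> 0) \<and>
        2 * card {j. pair_vec a (x, y) j \<noteq> 0} \<le> k \<and>
        \<rho> (real_vec (pair_vec a (x, x))) (real_vec (pair_vec a (x, y))) \<le> \<theta> \<and>
        \<rho> (real_vec (pair_vec a (x, y))) (real_vec (pair_vec a (y, x))) \<le> \<theta>) \<and>
     inj_on (pair_vec a) ({..<M} \<times> {..<M}) \<and>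
     (\<forall>x<M. \<forall>y<M. \<forall>x'<M. \<forall>y'<M. {x, y} \<inter> {x', y'} = {} \<longrightarrow>
        \<gamma> * \<theta> \<le> \<rho> (real_vec (pair_vec a (x, y))) (real_vec (pair_vec a (x', y'))))"

lemma gadgetD:
  assumes "gadget \<rho> d k M \<gamma> \<theta> a"
  shows gadget_pos: "0 < \<theta>"
    and gadget_sym: "\<rho> f g = \<rho> g f"
    and gadget_vec: "x < M \<Longrightarrow> y < M \<Longrightarrow> d \<le> j \<Longrightarrow> pair_vec a (x, y) j = 0"
      "x < M \<Longrightarrow> y < M \<Longrightarrow> \<bar>pair_vec a (x, y) j\<bar> \<le> 3"
      "x < M \<Longrightarrow> y < M \<Longrightarrow> \<exists>j. pair_vec a (x, y) j \<noteq> 0"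
      "x < M \<Longrightarrow> y < M \<Longrightarrow> 2 * card {j. pair_vec a (x, y) j \<noteq> 0} \<le> k"
    and gadget_near:
      "x < M \<Longrightarrow> y < M \<Longrightarrow>
        \<rho> (real_vec (pair_vec a (x, x))) (real_vec (pair_vec a (x, y))) \<le> \<theta>"
      "x < M \<Longrightarrow> y < M \<Longrightarrow>
        \<rho> (real_vec (pair_vec a (x, y))) (real_vec (pair_vec a (y, x))) \<le> \<theta>"
    and gadget_inj: "inj_on (pair_vec a) ({..<M} \<times> {..<M})"
    and gadget_far: "x < M \<Longrightarrow> y < M \<Longrightarrow> x' < M \<Longrightarrow> y' < M \<Longrightarrow> {x, y} \<inter> {x', y'} = {} \<Longrightarrow>
        \<gamma> * \<theta> \<le> \<rho> (real_vec (pair_vec a (x, y))) (real_vec (pair_vec a (x', y')))"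
  using assms unfolding gadget_def by simp_all

lemma gadget_inj_real:
  assumes "gadget \<rho> d k M \<gamma> \<theta> a"
  shows "inj_on (\<lambda>p. real_vec (pair_vec a p)) ({..<M} \<times> {..<M})"
proof (rule inj_onI)
  fix p q assume pq: "p \<in> {..<M} \<times> {..<M}" "q \<in> {..<M} \<times> {..<M}"
    and eq: "real_vec (pair_vec a p) = real_vec (pair_vec a q)"
  have "pair_vec a p = pair_vec a q"
    using fun_cong[OF eq] by (auto simp: real_vec_def)
  with pq show "p = q"
    using gadget_inj[OF assms] by (meson inj_onD)
qed

text \<open>Near points differ by e_x - e_y, of norm at most 2. Points of disjoint pairs have
  disjoint supports and norm 3 each, hence distance 6. The bound \<open>4 \<le> k\<close> is twice
  the support size 2.\<close>

lemma gadget_l1: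
  assumes "n \<le> d" "4 \<le> k"
  shows "gadget (l1_dist d) d k n 3 2 (\<lambda>x j. of_bool (j = x))"
proof -
  let ?a = "\<lambda>x j. of_bool (j = x) :: int"
  have sum_unit: "(\<Sum>j<d. c * real_of_int (of_bool (j = x))) = c" if "x < n" for x c
    using that assms by (simp add: of_bool_def if_distrib[of "\<lambda>t. c * t"] if_distrib[of real_of_int] cong: if_cong)
  have card_supp: "2 * card {j. pair_vec ?a (x, y) j \<noteq> 0} \<le> k" for x y
  proof -
    have "card {j. pair_vec ?a (x, y) j \<noteq> 0} \<le> card {x, y}"
      by (intro card_mono) (auto simp: pair_vec_def)
    also have "\<dots> \<le> 2" by (auto simp: card_insert_if)
    finally show ?thesis using assms by simp
  qed
  have near: "l1_dist d (real_vec (pair_vec ?a (x, x))) (real_vec (pair_vec ?a (x, y))) \<le> 2"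
    "l1_dist d (real_vec (pair_vec ?a (x, y))) (real_vec (pair_vec ?a (y, x))) \<le> 2"
    if "x < n" "y < n" for x y
  proof -
    have "(\<Sum>j<d. \<bar>real_vec (pair_vec ?a p) j - real_vec (pair_vec ?a q) j\<bar>)
       \<le> (\<Sum>j<d. 1 * real_of_int (of_bool (j = x)) + 1 * real_of_int (of_bool (j = y)))"
      if "p = (x, x) \<and> q = (x, y) \<or> p = (x, y) \<and> q = (y, x)" for p q
      using that by (intro sum_mono) (auto simp: real_vec_def pair_vec_def)
    then show "l1_dist d (real_vec (pair_vec ?a (x, x))) (real_vec (pair_vec ?a (x, y))) \<le> 2"
      "l1_dist d (real_vec (pair_vec ?a (x, y))) (real_vec (pair_vec ?a (y, x))) \<le> 2"
      unfolding l1_dist_def sum.distrib sum_unit[OF \<open>x < n\<close>] sum_unit[OF \<open>y < n\<close>] by auto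
  qed
  have far: "3 * 2 \<le> l1_dist d (real_vec (pair_vec ?a (x, y))) (real_vec (pair_vec ?a (x', y')))"
    if "x < n" "y < n" "x' < n" "y' < n" "{x, y} \<inter> {x', y'} = {}" for x y x' y'
  proof -
    have "6 = (\<Sum>j<d. 2 * real_of_int (of_bool (j = x)) + 1 * real_of_int (of_bool (j = y)) +
        2 * real_of_int (of_bool (j = x')) + 1 * real_of_int (of_bool (j = y')))"
      unfolding sum.distrib using that by (simp only: sum_unit)
    also have "\<dots> = (\<Sum>j<d. \<bar>real_vec (pair_vec ?a (x, y)) j - real_vec (pair_vec ?a (x', y')) j\<bar>)"
      using that by (intro sum.cong) (auto simp: real_vec_def pair_vec_def)
    finally show ?thesis by (simp add: l1_dist_def)
  qed
  have sym: "l1_dist d f g = l1_dist d g f" for f g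
    by (simp add: l1_dist_def abs_minus_commute)
  have inj: "inj_on (pair_vec ?a) ({..<n} \<times> {..<n})"
  proof (rule inj_onI)
    fix p q assume eq: "pair_vec ?a p = pair_vec ?a q"
    have "pair_vec ?a p j = pair_vec ?a q j" for j using eq by simp
    from this[of "fst p"] this[of "snd p"] this[of "fst q"] this[of "snd q"] show "p = q"
      by (auto simp: pair_vec_def prod_eq_iff of_bool_def split: if_splits)
  qed
  have bound: "\<bar>pair_vec ?a (x, y) j\<bar> \<le> 3" for x y j
    by (simp add: pair_vec_def)
  have zero: "pair_vec ?a (x, y) j = 0" if "x < n" "y < n" "d \<le> j" for x y j
    using that assms(1) by (simp add: pair_vec_def)
  have nonzero: "\<exists>j. pair_vec ?a (x, y) j \<noteq> 0" for x y
    by (rule exI[of _ x]) (auto simp: pair_vec_def)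
  show ?thesis
    unfolding gadget_def
    by (intro conjI allI impI near far card_supp inj nonzero sym bound zero;
        (assumption | simp)?)
qed

text \<open>Nearly orthogonal sign vectors of dimension \<open>K = k div 2\<close> are padded with
  zeros up to \<open>d\<close>; the halving pays for the factor 2 in the sparsity condition of
  \<open>gadget\<close>. Lengths are \<open>sqrt K\<close> and correlations at most
  \<open>K / 12\<close>, so all distances follow from inner products.\<close>

lemma gadget_l2:
  assumes "real n * (2 * exp (- real (k div 2) / 576)) < 1" "k \<le> d" "2 \<le> k"
  shows "\<exists>\<theta> a. gadget (l2_dist d) d k n (sqrt (7/2)) \<theta> a"
proof -
  define K where "K = k div 2"
  have K: "0 < K" "2 * K \<le> k" "K \<le> d"
    using assms by (auto simp: K_def)
  obtain b :: "nat \<Rightarrow> nat \<Rightarrow> int" where b: "\<And>x. x < n \<Longrightarrow> b x \<in> sign_vectors K"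
    and orth: "\<And>x y. x < n \<Longrightarrow> y < n \<Longrightarrow> x \<noteq> y \<Longrightarrow> 12 * \<bar>\<Sum>j<K. b x j * b y j\<bar> \<le> int K"
    using ex_nearly_orthogonal_sign_vectors[of n K] assms(1) K_def by blast
  define a where "a x j = (if j < K then b x j else 0)" for x j
  have sgn: "a x j = -1 \<or> a x j = 1" if "x < n" "j < K" for x j
    using b[OF that(1)] that(2) by (auto simp: a_def sign_vectors_def PiE_iff)
  have zero: "a x j = 0" if "K \<le> j" for x j
    using that by (simp add: a_def)
  \<comment> \<open>For signs s and t the number 2s + t is odd, so nothing cancels in the first
    \<open>K\<close> coordinates.\<close>
  have pair_zero_iff: "pair_vec a (x, y) j = 0 \<longleftrightarrow> K \<le> j" if "x < n" "y < n" for x y j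
    using sgn[of x j] sgn[of y j] zero[of j x] zero[of j y] that
    by (cases "j < K") (auto simp: pair_vec_def)
  define ip where "ip x y = (\<Sum>j<d. real_of_int (a x j) * real_of_int (a y j))" for x y
  have ip_alt: "ip x y = real_of_int (\<Sum>j<K. a x j * a y j)" for x y
  proof -
    have "ip x y = (\<Sum>j<K. real_of_int (a x j) * real_of_int (a y j))"
      unfolding ip_def by (rule sum.mono_neutral_right) (use K zero in auto)
    then show ?thesis by simp
  qed
  have ip_self: "ip x x = real K" if "x < n" for x
  proof -
    have "(\<Sum>j<K. a x j * a x j) = (\<Sum>j<K. 1)"
      by (rule sum.cong) (use sgn that in force)+
    then show ?thesis by (simp add: ip_alt)
  qed
  have ip_le: "12 * \<bar>ip x y\<bar> \<le> real K" if "x < n" "y < n" "x \<noteq> y" for x y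
  proof -
    have "(\<Sum>j<K. a x j * a y j) = (\<Sum>j<K. b x j * b y j)"
      by (simp add: a_def)
    with orth[OF that] have "real_of_int (12 * \<bar>\<Sum>j<K. a x j * a y j\<bar>) \<le> real_of_int (int K)"
      unfolding of_int_le_iff by simp
    then show ?thesis by (simp add: ip_alt)
  qed
  \<comment> \<open>The lower bound includes \<open>x = y\<close>, where the inner product is
    \<open>K\<close>; this lets the distance estimates treat diagonal pairs alike.\<close>
  have ip_ge: "- real K \<le> 12 * ip x y" if "x < n" "y < n" for x y
    using ip_le[OF that] ip_self[OF that(1)] by (cases "x = y") auto
  have ip_sym: "ip x y = ip y x" for x y
    by (simp add: ip_def mult.commute)
  have dist: "(l2_dist d (real_vec (pair_vec a (x, y))) (real_vec (pair_vec a (x', y'))))\<^sup>2 =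
      4 * ip x x + 4 * ip x y + ip y y + 4 * ip x' x' + 4 * ip x' y' + ip y' y' -
      2 * (4 * ip x x' + 2 * ip x y' + 2 * ip y x' + ip y y')" for x y x' y'
  proof -
    have "(l2_dist d (real_vec (pair_vec a (x, y))) (real_vec (pair_vec a (x', y'))))\<^sup>2 =
        (\<Sum>j<d. (real_vec (pair_vec a (x, y)) j - real_vec (pair_vec a (x', y')) j)\<^sup>2)"
      unfolding l2_dist_def L2_set_def by (simp add: sum_nonneg)
    then show ?thesis
      unfolding ip_def
      by (simp add: real_vec_def pair_vec_def power2_eq_square algebra_simps
          sum.distrib sum_subtractf sum_distrib_left)
  qed
  have dist_nonneg: "0 \<le> l2_dist d f g" for f g
    by (simp add: l2_dist_def)
  \<comment> \<open>Both differences are \<open>a x - a y\<close>, of squared length 2K - 2 ip x y,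
    which is at most 2K + K/6 = 13K/6.\<close>
  have near: "l2_dist d (real_vec (pair_vec a (x, x))) (real_vec (pair_vec a (x, y))) \<le> sqrt (13/6 * real K)"
    "l2_dist d (real_vec (pair_vec a (x, y))) (real_vec (pair_vec a (y, x))) \<le> sqrt (13/6 * real K)"
    if "x < n" "y < n" for x y
  proof -
    note bounds = ip_ge[OF that] ip_self[OF that(1)] ip_self[OF that(2)] ip_sym[of x y]
    show "l2_dist d (real_vec (pair_vec a (x, x))) (real_vec (pair_vec a (x, y))) \<le> sqrt (13/6 * real K)"
      by (rule real_le_rsqrt) (use bounds in \<open>simp add: dist\<close>)
    show "l2_dist d (real_vec (pair_vec a (x, y))) (real_vec (pair_vec a (y, x))) \<le> sqrt (13/6 * real K)"
      by (rule real_le_rsqrt) (use bounds in \<open>simp add: dist\<close>)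
  qed
  \<comment> \<open>Each point has squared length at least 5K - K/3, and the mixed term is at most 2
    * 9 * K/12. This leaves 47K/6 = 94K/12, while 7/2 * 13K/6 is 91K/12.\<close>
  have far: "sqrt (7/2) * sqrt (13/6 * real K)
      \<le> l2_dist d (real_vec (pair_vec a (x, y))) (real_vec (pair_vec a (x', y')))"
    if "x < n" "y < n" "x' < n" "y' < n" "{x, y} \<inter> {x', y'} = {}" for x y x' y'
    unfolding real_sqrt_mult[symmetric]
  proof (rule real_le_lsqrt[OF dist_nonneg])
    show "7/2 * (13/6 * real K)
        \<le> (l2_dist d (real_vec (pair_vec a (x, y))) (real_vec (pair_vec a (x', y'))))\<^sup>2"
    proof -
      have "12 * ip u v \<le> real K" if "u < n" "v < n" "u \<noteq> v" for u v
        using ip_le[OF that] by linarith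
      then have "12 * ip x x' \<le> real K" "12 * ip x y' \<le> real K" "12 * ip y x' \<le> real K" "12 * ip y y' \<le> real K"
        using that by auto
      with ip_ge[OF that(1,2)] ip_ge[OF that(3,4)] show ?thesis
        unfolding dist that(1-4)[THEN ip_self] by (simp add: field_simps)
    qed
  qed
  have sym: "l2_dist d f g = l2_dist d g f" for f g
    by (simp add: l2_dist_def L2_set_def power2_commute)
  \<comment> \<open>Equal vectors would have inner product \<open>K\<close>, above the limit
    \<open>K / 12\<close> for distinct indices.\<close>
  have a_inj: "x = x'" if "x < n" "x' < n" "\<And>j. j < K \<Longrightarrow> a x j = a x' j" for x x'
  proof (rule ccontr)
    assume "x \<noteq> x'"
    moreover have "ip x x' = ip x x"
      unfolding ip_alt using that(3) by simp
    ultimately show False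
      using ip_le[of x x'] ip_self[of x] that(1,2) K(1) by simp
  qed
  have inj: "inj_on (pair_vec a) ({..<n} \<times> {..<n})"
  proof (rule inj_onI)
    fix p q assume pq: "p \<in> {..<n} \<times> {..<n}" "q \<in> {..<n} \<times> {..<n}" "pair_vec a p = pair_vec a q"
    \<comment> \<open>The four sign choices (s, t) give four different values 3, 1, -1, -3 of 2s +
      t, so each coordinate determines both signs.\<close>
    have "a (fst p) j = a (fst q) j \<and> a (snd p) j = a (snd q) j" if "j < K" for j
    proof -
      have "a u j = -1 \<or> a u j = 1" if "u \<in> {fst p, snd p, fst q, snd q}" for u
      proof -
        have "u < n" using pq(1,2) that by auto
        then show ?thesis using sgn \<open>j < K\<close> by simp
      qed
      moreover have "2 * a (fst p) j + a (snd p) j = 2 * a (fst q) j + a (snd q) j"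
        using fun_cong[OF pq(3), of j] by (simp add: pair_vec_def)
      ultimately show ?thesis
        by (smt (verit) insertCI)
    qed
    moreover have "fst p < n" "snd p < n" "fst q < n" "snd q < n"
      using pq(1,2) by auto
    ultimately show "p = q"
      by (intro prod_eqI a_inj) simp_all
  qed
  have card_supp: "2 * card {j. pair_vec a (x, y) j \<noteq> 0} \<le> k" if "x < n" "y < n" for x y
  proof -
    have "{j. pair_vec a (x, y) j \<noteq> 0} = {..<K}"
      by (simp add: set_eq_iff pair_zero_iff[OF that] not_le)
    then show ?thesis using K by simp
  qed
  have nonzero: "\<exists>j. pair_vec a (x, y) j \<noteq> 0" if "x < n" "y < n" for x y
    using K pair_zero_iff[OF that, of 0] by auto
  have bound: "\<bar>pair_vec a (x, y) j\<bar> \<le> 3" if "x < n" "y < n" for x y j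
    using sgn[of x j] sgn[of y j] zero[of j x] zero[of j y] that
    by (cases "j < K") (auto simp: pair_vec_def)
  have "gadget (l2_dist d) d k n (sqrt (7/2)) (sqrt (13/6 * real K)) a"
    unfolding gadget_def
    by (intro conjI allI impI near far card_supp inj nonzero bound sym;
        (assumption | use K pair_zero_iff in simp)?)
  then show ?thesis by blast
qed

section \<open>Clustering value of a graph\<close>

definition bipartitions :: "'a set \<Rightarrow> ('a set \<times> 'a set) set" where
  "bipartitions V = {(C1, C2). C1 \<noteq> {} \<and> C2 \<noteq> {} \<and> C1 \<inter> C2 = {} \<and> C1 \<union> C2 = V}"

lemma slc2_bipartitions:
  "slc2 \<rho> V = Max ((\<lambda>(C1, C2). Min ((\<lambda>(a, b). \<rho> a b) ` (C1 \<times> C2))) ` bipartitions V)"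
proof -
  have "{\<rho> a b | a b. a \<in> C1 \<and> b \<in> C2} = (\<lambda>(a, b). \<rho> a b) ` (C1 \<times> C2)" for C1 C2
    by auto
  then show ?thesis
    unfolding slc2_def bipartitions_def by (intro arg_cong[of _ _ Max]) auto
qed

lemma finite_bipartitions: "finite V \<Longrightarrow> finite (bipartitions V)"
  by (rule finite_subset[of _ "Pow V \<times> Pow V"]) (auto simp: bipartitions_def)

lemma slc2_le:
  assumes "finite V" "bipartitions V \<noteq> {}"
    and "\<And>C1 C2. (C1, C2) \<in> bipartitions V \<Longrightarrow> \<exists>a\<in>C1. \<exists>b\<in>C2. \<rho> a b \<le> \<theta>"
  shows "slc2 \<rho> V \<le> \<theta>"
proof -
  have "Min ((\<lambda>(a, b). \<rho> a b) ` (C1 \<times> C2)) \<le> \<theta>" if C: "(C1, C2) \<in> bipartitions V" for C1 C2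
  proof -
    have "finite C1" "finite C2"
      using C assms(1) by (auto simp: bipartitions_def)
    moreover obtain a b where "a \<in> C1" "b \<in> C2" "\<rho> a b \<le> \<theta>"
      using assms(3)[OF C] by blast
    ultimately have "Min ((\<lambda>(a, b). \<rho> a b) ` (C1 \<times> C2)) \<le> \<rho> a b"
      by (intro Min_le) force+
    with \<open>\<rho> a b \<le> \<theta>\<close> show ?thesis by simp
  qed
  then show ?thesis
    unfolding slc2_bipartitions using assms(1,2) finite_bipartitions by (subst Max_le_iff) auto
qed

lemma slc2_ge:
  assumes "finite V" and C: "(C1, C2) \<in> bipartitions V"
    and "\<And>a b. a \<in> C1 \<Longrightarrow> b \<in> C2 \<Longrightarrow> \<theta> \<le> \<rho> a b"
  shows "\<theta> \<le> slc2 \<rho> V"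
proof -
  have "finite C1" "finite C2" "C1 \<noteq> {}" "C2 \<noteq> {}"
    using C assms(1) by (auto simp: bipartitions_def)
  then have "\<theta> \<le> Min ((\<lambda>(a, b). \<rho> a b) ` (C1 \<times> C2))"
    using assms(3) by (subst Min_ge_iff) auto
  also have "\<dots> \<le> slc2 \<rho> V"
    unfolding slc2_bipartitions using C assms(1) finite_bipartitions by (intro Max_ge) force+
  finally show ?thesis .
qed

text \<open>
  A pair \<open>(x, y) \<in> R\<close> stands for the point \<open>2a\<^sub>x + a\<^sub>y\<close>; thus \<open>(u, u)\<close> is a vertex, and an edge occurs
  in both orientations.  The pairs involving some \<open>y \<ge> n\<close> are the dummy edges at vertex \<open>0\<close>.
\<close>

locale padded_graph =
  fixes n M :: nat and E R :: "(nat \<times> nat) set"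
  assumes n_pos: "0 < n"
    and edges: "E \<subseteq> {..<n} \<times> {..<n}"
    and vertices: "u < n \<Longrightarrow> (u, u) \<in> R"
    and edges_R: "E \<subseteq> R"
    and R_sym: "(x, y) \<in> R \<Longrightarrow> (y, x) \<in> R"
    and R_less: "R \<subseteq> {..<M} \<times> {..<M}"
    and R_cases: "(x, y) \<in> R \<Longrightarrow>
       x < n \<and> x = y \<or> (x, y) \<in> E \<or> (y, x) \<in> E \<or> x = 0 \<and> n \<le> y \<or> y = 0 \<and> n \<le> x"
begin

lemma finite_R: "finite R"
  using R_less by (rule finite_subset) auto

text \<open>If all distances across a bipartition exceeded \<open>\<theta>\<close>, near points
  would lie on the same side. The steps (u, u), (u, v), (v, u), (v, v) along edges, and (0, 0), (0,
  y), (y, 0) along dummy edges, would then put all points on one side.\<close>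

lemma slc2_connected:
  assumes G: "gadget \<rho> d k M \<gamma> \<theta> a" and conn: "connected_graph n E"
    and big: "1 < card R"
  shows "slc2 \<rho> ((\<lambda>p. real_vec (pair_vec a p)) ` R) \<le> \<theta>"
proof (rule slc2_le)
  let ?P = "\<lambda>p. real_vec (pair_vec a p)"
  have inj: "inj_on ?P R"
    using gadget_inj_real[OF G] R_less by (rule inj_on_subset)
  show "finite (?P ` R)"
    using finite_R by simp
  obtain p where p: "p \<in> R"
    using vertices n_pos by blast
  \<comment> \<open>A bipartition must exist for the maximum in \<open>slc2\<close> to range over a
    nonempty set; splitting off one point provides it.\<close>
  have "R \<noteq> {p}" using big by auto
  with p have "({?P p}, ?P ` (R - {p})) \<in> bipartitions (?P ` R)"
    using inj by (auto simp: bipartitions_def inj_on_def)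
  then show "bipartitions (?P ` R) \<noteq> {}" by blast
  fix C1 C2 assume C: "(C1, C2) \<in> bipartitions (?P ` R)"
  show "\<exists>a\<in>C1. \<exists>b\<in>C2. \<rho> a b \<le> \<theta>"
  proof (rule ccontr)
    assume no: "\<not> ?thesis"
    have near: "\<rho> (?P (x, x)) (?P (x, y)) \<le> \<theta>" "\<rho> (?P (x, y)) (?P (y, x)) \<le> \<theta>"
      if "(x, y) \<in> R" for x y
      using gadget_near[OF G] that R_less by auto
    have C_R: "?P p \<in> C1 \<longleftrightarrow> ?P p \<notin> C2" if "p \<in> R" for p
      using C that by (auto simp: bipartitions_def)
    have link: "?P p \<in> C1 \<longleftrightarrow> ?P q \<in> C1" if "p \<in> R" "q \<in> R" "\<rho> (?P p) (?P q) \<le> \<theta>" for p q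
      using that C_R[of p] C_R[of q] no gadget_sym[OF G] by metis
    have swap: "?P (x, y) \<in> C1 \<longleftrightarrow> ?P (y, x) \<in> C1" if "(x, y) \<in> R" for x y
      using link near(2) that R_sym by blast
    have start: "?P (x, x) \<in> C1 \<longleftrightarrow> ?P (x, y) \<in> C1" if "(x, y) \<in> R" "x < n" for x y
      using link near(1) that vertices by blast
    have edge: "?P (u, u) \<in> C1 \<longleftrightarrow> ?P (v, v) \<in> C1" if "(u, v) \<in> E \<union> E\<inverse>" for u v
    proof -
      have "(u, v) \<in> R" "u < n" "v < n"
        using that edges edges_R R_sym by auto
      then show ?thesis
        using start[of u v] start[of v u] swap[of u v] R_sym[of u v] by blast
    qed
    have path: "?P (u, u) \<in> C1 \<longleftrightarrow> ?P (v, v) \<in> C1" if "(u, v) \<in> (E \<union> E\<inverse>)\<^sup>*" for u v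
      using that by (induction rule: rtrancl_induct) (use edge in blast)+
    have all: "?P (u, u) \<in> C1 \<longleftrightarrow> ?P (0, 0) \<in> C1" if "u < n" for u
      using path that n_pos conn unfolding connected_graph_def by blast
    \<comment> \<open>A dummy vertex has no diagonal point, but every pair has a component below
      \<open>n\<close> from which its two orientations are reached.\<close>
    have const: "?P (x, y) \<in> C1 \<longleftrightarrow> ?P (0, 0) \<in> C1" if "(x, y) \<in> R" for x y
    proof -
      have "x < n \<or> y < n"
        using R_cases[OF that] edges n_pos by auto
      then show ?thesis
        using start[OF that] start[OF R_sym[OF that]] swap[OF that] all by blast
    qed
    have "C1 \<noteq> {}" "C2 \<noteq> {}" "C1 \<subseteq> ?P ` R" "C2 \<subseteq> ?P ` R"
      using C by (auto simp: bipartitions_def)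
    then obtain p q where "p \<in> R" "q \<in> R" "?P p \<in> C1" "?P q \<in> C2"
      by blast
    then show False
      using C_R[of q] const[of "fst p" "snd p"] const[of "fst q" "snd q"] by simp
  qed
qed

text \<open>The witness partition separates the component of \<open>u\<close> from the rest. The two
  components of a pair in \<open>R\<close> always lie on the same side, so pairs from different
  sides are disjoint and the far condition of the gadget applies.\<close>

lemma slc2_disconnected:
  assumes G: "gadget \<rho> d k M \<gamma> \<theta> a" and disconn: "\<not> connected_graph n E"
  shows "\<gamma> * \<theta> \<le> slc2 \<rho> ((\<lambda>p. real_vec (pair_vec a p)) ` R)"
proof -
  let ?P = "\<lambda>p. real_vec (pair_vec a p)"
  obtain u v where uv: "u < n" "v < n" "(u, v) \<notin> (E \<union> E\<inverse>)\<^sup>*"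
    using disconn unfolding connected_graph_def by blast
  \<comment> \<open>Dummy vertices are counted with vertex 0, to which their edges are
    attached.\<close>
  define reach where "reach x \<longleftrightarrow> (u, if x < n then x else 0) \<in> (E \<union> E\<inverse>)\<^sup>*" for x
  have step: "(u, x) \<in> (E \<union> E\<inverse>)\<^sup>* \<longleftrightarrow> (u, y) \<in> (E \<union> E\<inverse>)\<^sup>*"
    if "(x, y) \<in> E \<or> (y, x) \<in> E" for x y
    using that by (metis UnI1 UnI2 converse_iff rtrancl.rtrancl_into_rtrancl)
  have same: "reach x \<longleftrightarrow> reach y" if "(x, y) \<in> R" for x y
    using R_cases[OF that] edges n_pos step[of x y] by (auto simp: reach_def)
  let ?R1 = "{p \<in> R. reach (fst p)}" and ?R2 = "{p \<in> R. \<not> reach (fst p)}"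
  have far: "\<gamma> * \<theta> \<le> \<rho> (?P p) (?P q)" if "p \<in> ?R1" "q \<in> ?R2" for p q
  proof -
    obtain x y x' y' where pq: "p = (x, y)" "q = (x', y')"
      by (cases p, cases q)
    have "reach x" "reach y" "\<not> reach x'" "\<not> reach y'"
      using that same unfolding pq by auto
    then have "{x, y} \<inter> {x', y'} = {}" by auto
    moreover have "x < M" "y < M" "x' < M" "y' < M"
      using that R_less unfolding pq by auto
    ultimately show ?thesis
      using gadget_far[OF G] unfolding pq by blast
  qed
  show ?thesis
  proof (rule slc2_ge)
    show "finite (?P ` R)"
      using finite_R by simp
    have "?P p \<noteq> ?P q" if "p \<in> ?R1" "q \<in> ?R2" for p q
    proof
      assume "?P p = ?P q"
      moreover have "p \<in> {..<M} \<times> {..<M}" "q \<in> {..<M} \<times> {..<M}"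
        using that R_less by auto
      ultimately have "p = q"
        using gadget_inj_real[OF G] by (meson inj_onD)
      with that show False by simp
    qed
    then have "?P ` ?R1 \<inter> ?P ` ?R2 = {}"
      by blast
    moreover have "(u, u) \<in> ?R1" "(v, v) \<in> ?R2"
      using uv vertices by (auto simp: reach_def)
    ultimately show "(?P ` ?R1, ?P ` ?R2) \<in> bipartitions (?P ` R)"
      unfolding bipartitions_def by blast
  qed (use far in blast)
qed

end

section \<open>Cycle instances as connectivity instances\<close>

lemma is_cycle_edges:
  assumes "is_cycle V E"
  shows "E \<subseteq> {(u, v). u < v} \<inter> V \<times> V"
proof -
  obtain p where p: "distinct p" "3 \<le> length p" "set p = V" "E = cycle_edges p"
    using assms by (auto simp: is_cycle_def)
  show "E \<subseteq> {(u, v). u < v} \<inter> V \<times> V"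
  proof
    fix e assume "e \<in> E"
    then obtain i where i: "i < length p"
      "e = (min (p ! i) (p ! (Suc i mod length p)), max (p ! i) (p ! (Suc i mod length p)))"
      unfolding p(4) cycle_edges_def by auto
    have j: "Suc i mod length p < length p"
      using i(1) by (intro mod_less_divisor) linarith
    have "Suc i mod length p \<noteq> i"
      using p(2) i(1) by (cases "Suc i = length p") auto
    then have "p ! i \<noteq> p ! (Suc i mod length p)"
      using nth_eq_iff_index_eq[OF p(1) i(1) j] by simp
    then have "fst e < snd e" using i(2) by (auto simp: min_def max_def)
    moreover have "p ! i \<in> V" "p ! (Suc i mod length p) \<in> V"
      using p(3) i(1) j by auto
    ultimately show "e \<in> {(u, v). u < v} \<inter> V \<times> V"
      unfolding i(2) by (auto simp: min_def max_def)
  qed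
qed

lemma is_cycle_connected:
  assumes "is_cycle V E" "u \<in> V" "v \<in> V"
  shows "(u, v) \<in> (E \<union> E\<inverse>)\<^sup>*"
proof -
  obtain p where p: "set p = V" "E = cycle_edges p"
    using assms by (auto simp: is_cycle_def)
  have from_0: "(p ! 0, p ! i) \<in> (E \<union> E\<inverse>)\<^sup>*" if "i < length p" for i
    using that
  proof (induction i)
    case (Suc i)
    have "(min (p ! i) (p ! Suc i), max (p ! i) (p ! Suc i)) \<in> E"
      unfolding p(2) cycle_edges_def using Suc.prems
      by (simp, intro exI[of _ "p ! i"] exI[of _ "p ! Suc i"] conjI exI[of _ i]) auto
    then have "(p ! i, p ! Suc i) \<in> E \<union> E\<inverse>"
      by (auto simp: min_def max_def split: if_splits)
    with Suc show ?case
      by (meson Suc_lessD rtrancl.rtrancl_into_rtrancl)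
  qed simp
  have sym: "sym ((E \<union> E\<inverse>)\<^sup>*)"
    by (intro sym_rtrancl sym_Un_converse)
  obtain i j where "i < length p" "j < length p" "u = p ! i" "v = p ! j"
    using assms(2,3) p(1) by (metis in_set_conv_nth)
  then show ?thesis
    using from_0 sym by (meson rtrancl_trans symD)
qed

text \<open>A single cycle is connected, and in the case of two cycles no edge leaves
  \<open>V1\<close>. Hence an algorithm that decides connectivity also tells the two cases
  apart.\<close>

lemma cycle_problem_connectivity:
  assumes "(X, Y) \<in> cycle_problem n"
  shows "X \<subseteq> {(u, v). u < v \<and> v < n} \<and> Y = {connected_graph n X}"
proof -
  consider "is_cycle {..<n} X" "Y = {True}" | "two_cycles n X" "Y = {False}"
    using assms by (auto simp: cycle_problem_def split: if_splits)
  then show ?thesis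
  proof cases
    case 1
    then show ?thesis
      using is_cycle_edges[OF 1(1)] is_cycle_connected[OF 1(1)] by (auto simp: connected_graph_def)
  next
    case 2
    then obtain V1 V2 E1 E2 where V: "V1 \<union> V2 = {..<n}" "V1 \<inter> V2 = {}"
      and cyc: "is_cycle V1 E1" "is_cycle V2 E2" and X: "X = E1 \<union> E2"
      unfolding two_cycles_def by blast
    note E = is_cycle_edges[OF cyc(1)] is_cycle_edges[OF cyc(2)]
    have "V1 \<subseteq> {..<n}" "V2 \<subseteq> {..<n}"
      using V by auto
    then have "X \<subseteq> {(u, v). u < v \<and> v < n}"
      unfolding X using E by auto
    moreover have "\<not> connected_graph n X"
    proof
      assume conn: "connected_graph n X"
      have "V1 \<noteq> {}" "V2 \<noteq> {}"
        using cyc by (auto simp: is_cycle_def)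
      then obtain u v where uv: "u \<in> V1" "v \<in> V2" by blast
      then have "(u, v) \<in> (X \<union> X\<inverse>)\<^sup>*"
        using conn \<open>V1 \<subseteq> {..<n}\<close> \<open>V2 \<subseteq> {..<n}\<close> unfolding connected_graph_def by blast
      then have "v \<in> V1"
      proof (induction rule: rtrancl_induct)
        case base
        then show ?case using uv by simp
      next
        case (step y z)
        then show ?case
          unfolding X using E V(2) by auto
      qed
      with uv V(2) show False by blast
    qed
    ultimately show ?thesis using 2 by simp
  qed
qed

section \<open>The reduction\<close>

text \<open>Rewriting the input costs one round without communication, so \<open>A\<close> runs with
  its clock shifted by one.\<close>

definition preprocess :: "(nat \<Rightarrow> int list \<Rightarrow> int list) \<Rightarrow> ('o \<Rightarrow> 'p) \<Rightarrow> 'o mpc \<Rightarrow> 'p mpc" where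
  "preprocess f g A =
     \<lparr>machines = machines A, rounds = Suc (rounds A),
      keep = (\<lambda>t i x. if t = 0 then f i x else keep A (t - 1) i x),
      send = (\<lambda>t i x j. if t = 0 then [] else send A (t - 1) i x j),
      result = (\<lambda>x. g (result A x))\<rparr>"

lemma preprocess_simps [simp]:
  "machines (preprocess f g A) = machines A"
  "rounds (preprocess f g A) = Suc (rounds A)"
  "keep (preprocess f g A) 0 = f"
  "keep (preprocess f g A) (Suc t) = keep A t"
  "send (preprocess f g A) 0 i x j = []"
  "send (preprocess f g A) (Suc t) = send A t"
  "result (preprocess f g A) x = g (result A x)"
  by (simp_all add: preprocess_def)

lemma memory_preprocess:
  "memory (preprocess f g A) M (Suc t) = memory A (\<lambda>i. f i (M i)) t"
proof (induction t)
  case 0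
  show ?case by (simp add: fun_eq_iff del: upt_Suc)
next
  case (Suc t)
  show ?case
    unfolding fun_eq_iff memory.simps(2)[of _ _ "Suc t"] Suc.IH by simp
qed

text \<open>From time 1 on the limits are those of \<open>A\<close> on the rewritten input. Only the
  raw input at time 0 has to be checked separately, and its words may require a larger bound
  \<open>W'\<close>.\<close>

lemma within_limits_preprocess:
  assumes A: "within_limits A s W (\<lambda>i. f i (M i))"
    and init: "\<And>j. j < machines A \<Longrightarrow> length (M j) \<le> s"
      "\<And>j x. j < machines A \<Longrightarrow> x \<in> set (M j) \<Longrightarrow> \<bar>x\<bar> \<le> int W'"
    and "W \<le> W'"
  shows "within_limits (preprocess f g A) s W' M"
  unfolding within_limits_def
proof (intro conjI allI impI)
  fix t j assume t: "t \<le> rounds (preprocess f g A)" and j: "j < machines (preprocess f g A)"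
  show "length (memory (preprocess f g A) M t j) \<le> s"
    using A init(1) t j by (cases t) (auto simp: within_limits_def memory_preprocess simp del: memory.simps(2))
  show "\<forall>x\<in>set (memory (preprocess f g A) M t j). \<bar>x\<bar> \<le> int W'"
  proof (cases t)
    case (Suc t')
    then have "\<bar>x\<bar> \<le> int W" if "x \<in> set (memory (preprocess f g A) M t j)" for x
      using A t j that by (auto simp: within_limits_def memory_preprocess simp del: memory.simps(2))
    with \<open>W \<le> W'\<close> show ?thesis by force
  qed (use init(2) j in simp)
next
  fix t i assume t: "t < rounds (preprocess f g A)" and i: "i < machines (preprocess f g A)"
  let ?mem = "memory (preprocess f g A) M t"
  have "(\<Sum>j<machines A. length (send (preprocess f g A) t i (?mem i) j)) \<le> s \<and>
        (\<Sum>j<machines A. length (send (preprocess f g A) t j (?mem j) i)) \<le> s"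
    using A t i by (cases t) (auto simp: within_limits_def memory_preprocess simp del: memory.simps(2))
  then show
    "(\<Sum>j<machines (preprocess f g A). length (send (preprocess f g A) t i (?mem i) j)) \<le> s"
    "(\<Sum>j<machines (preprocess f g A). length (send (preprocess f g A) t j (?mem j) i)) \<le> s"
    by simp_all
qed

text \<open>Splits the distinctness condition of \<open>distributes\<close> into one condition per
  machine and one per pair of machines. It serves both to read off the given distribution of edges
  and to verify that of the entries.\<close>

lemma distinct_concat_map_iff:
  assumes "distinct xs"
  shows "distinct (concat (map f xs)) \<longleftrightarrow>
    (\<forall>x\<in>set xs. distinct (f x)) \<and> (\<forall>x\<in>set xs. \<forall>y\<in>set xs. x \<noteq> y \<longrightarrow> set (f x) \<inter> set (f y) = {})"
  using assms
proof (induction xs)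
  case (Cons x xs)
  let ?disj = "\<lambda>y z. set (f y) \<inter> set (f z) = {}"
  have pairs: "(\<forall>y\<in>set (x # xs). \<forall>z\<in>set (x # xs). y \<noteq> z \<longrightarrow> P y z) \<longleftrightarrow>
      (\<forall>y\<in>set xs. \<forall>z\<in>set xs. y \<noteq> z \<longrightarrow> P y z) \<and> (\<forall>y\<in>set xs. P x y)"
    if "\<And>y z. P y z \<Longrightarrow> P z y" for P
    using Cons.prems that by auto
  have "(\<forall>y\<in>set (x # xs). \<forall>z\<in>set (x # xs). y \<noteq> z \<longrightarrow> ?disj y z) \<longleftrightarrow>
      (\<forall>y\<in>set xs. \<forall>z\<in>set xs. y \<noteq> z \<longrightarrow> ?disj y z) \<and> (\<forall>y\<in>set xs. ?disj x y)"
    by (rule pairs) (simp only: Int_commute)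
  moreover have "distinct (concat (map f (x # xs))) \<longleftrightarrow>
      distinct (f x) \<and> distinct (concat (map f xs)) \<and> (\<forall>y\<in>set xs. ?disj x y)"
    by auto
  ultimately show ?case
    using Cons by (simp del: distinct.simps list.set concat.simps list.map) (simp add: conj_ac)
qed simp

section \<open>Slots, and the points owned by a machine\<close>

fun decode_edges :: "int list \<Rightarrow> (nat \<times> nat) list" where
  "decode_edges (x # y # xs) = (nat x, nat y) # decode_edges xs"
| "decode_edges xs = []"

lemma decode_edges_concat_enc_edge [simp]: "decode_edges (concat (map enc_edge l)) = l"
  by (induction l) (auto simp: enc_edge_def)

text \<open>
  Slot \<open>w\<close> belongs to machine \<open>w mod m\<close> and receives its edge number \<open>w div m\<close>, if there is one.  The
  points \<open>i < n\<close> are the vertices; the points \<open>n + 2w\<close> and \<open>n + 2w + 1\<close> belong to slot \<open>w\<close>.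
\<close>

definition slot_pair :: "nat \<Rightarrow> nat \<Rightarrow> (nat \<times> nat) list \<Rightarrow> nat \<Rightarrow> nat \<times> nat" where
  "slot_pair n m l w = (if w div m < length l then l ! (w div m) else (0, n + w))"

definition index_pair :: "nat \<Rightarrow> nat \<Rightarrow> (nat \<times> nat) list \<Rightarrow> nat \<Rightarrow> nat \<times> nat" where
  "index_pair n m l i =
     (if i < n then (i, i)
      else if even (i - n) then slot_pair n m l ((i - n) div 2)
      else prod.swap (slot_pair n m l ((i - n) div 2)))"

definition owner :: "nat \<Rightarrow> nat \<Rightarrow> nat \<Rightarrow> nat" where
  "owner n m i = (if i < n then i else (i - n) div 2) mod m"

definition vec_entries :: "nat \<Rightarrow> (nat \<Rightarrow> int) \<Rightarrow> nat \<Rightarrow> (nat \<times> nat \<times> rat) list" where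
  "vec_entries d f i = map (\<lambda>c. (i, c, of_int (f c))) (filter (\<lambda>c. f c \<noteq> 0) [0..<d])"

text \<open>The input enters only through the edge list \<open>l\<close> of machine \<open>j\<close>
  itself, as a local computation requires.\<close>

definition machine_entries ::
  "nat \<Rightarrow> nat \<Rightarrow> nat \<Rightarrow> nat \<Rightarrow> (nat \<Rightarrow> nat \<Rightarrow> int) \<Rightarrow> nat \<Rightarrow> (nat \<times> nat) list \<Rightarrow> (nat \<times> nat \<times> rat) list" where
  "machine_entries n n' m d a j l =
     concat (map (\<lambda>i. vec_entries d (pair_vec a (index_pair n m l i)) i)
       (filter (\<lambda>i. owner n m i = j) [0..<n']))"

text \<open>A residue class modulo \<open>m\<close> contains at most n div m + 1 vertices and S div
  m + 1 slots, and a slot carries two points; the rounding terms 1 + 2 give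
  \<open>3 * m\<close>.\<close>

lemma card_owner_le:
  assumes "0 < m"
  shows "m * card {i. i < n + 2 * S \<and> owner n m i = j} \<le> n + 2 * S + 3 * m"
proof -
  have "{i. i < n + 2 * S \<and> owner n m i = j} \<subseteq>
      (\<lambda>p. p * m + j) ` {..n div m} \<union> (\<lambda>(p, e). n + 2 * (p * m + j) + e) ` ({..S div m} \<times> {0, 1})"
    (is "_ \<subseteq> ?A \<union> ?B")
  proof
    fix i assume i: "i \<in> {i. i < n + 2 * S \<and> owner n m i = j}"
    show "i \<in> ?A \<union> ?B"
    proof (cases "i < n")
      case True
      then have "i = i div m * m + j" "i div m \<le> n div m"
        using i by (auto simp: owner_def div_le_mono)
      then show ?thesis by blast
    next
      case False
      define w where "w = (i - n) div 2"
      have w: "w div m * m + j = w" "w div m \<le> S div m"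
        using i False by (auto simp: owner_def w_def intro!: div_le_mono)
      have "i = n + 2 * w + (i - n) mod 2"
        using False by (simp add: w_def)
      with w have "i = (\<lambda>(p, e). n + 2 * (p * m + j) + e) (w div m, (i - n) mod 2)"
        by simp
      moreover have "(w div m, (i - n) mod 2) \<in> {..S div m} \<times> {0, 1}"
        using w(2) by auto
      ultimately have "i \<in> ?B" by (rule image_eqI)
      then show ?thesis by blast
    qed
  qed
  then have "card {i. i < n + 2 * S \<and> owner n m i = j} \<le> card (?A \<union> ?B)"
    by (rule card_mono[rotated]) auto
  also have "\<dots> \<le> card ?A + card ?B"
    by (rule card_Un_le)
  also have "\<dots> \<le> card {..n div m} + card ({..S div m} \<times> {0, 1::nat})"
    by (intro add_mono card_image_le) auto
  also have "\<dots> = n div m + 2 * (S div m) + 3"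
    by simp
  finally have "m * card {i. i < n + 2 * S \<and> owner n m i = j} \<le> m * (n div m + 2 * (S div m) + 3)"
    by simp
  also have "\<dots> = m * (n div m) + 2 * (m * (S div m)) + 3 * m"
    by (simp add: algebra_simps)
  also have "\<dots> \<le> n + 2 * S + 3 * m"
    by (intro add_mono mult_le_mono) auto
  finally show ?thesis .
qed

section \<open>The padded graph given by a distribution of the edges\<close>

locale distributed_graph =
  fixes n m C :: nat and E :: "(nat \<times> nat) set" and D :: "nat \<Rightarrow> (nat \<times> nat) list"
  assumes m_pos: "0 < m" and m_le: "m \<le> n"
    and E_subset: "E \<subseteq> {(u, v). u < v \<and> v < n}"
    and dist: "distributes m (C * n) E D"
begin

text \<open>Balance gives p * m < C * n for the position p of an edge on its machine. The machine
  number adds less than m, which is at most n, and this accounts for the \<open>+ 1\<close>.\<close>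

definition slots :: nat where "slots = (C + 1) * n"

definition slot :: "nat \<Rightarrow> nat \<times> nat" where
  "slot w = slot_pair n m (D (w mod m)) w"

definition index :: "nat \<Rightarrow> nat \<times> nat" where
  "index i = index_pair n m (D (owner n m i)) i"

abbreviation size :: nat where "size \<equiv> n + 2 * slots"

lemma n_pos: "0 < n"
  using m_pos m_le by simp

lemma set_D: "(\<Union>i<m. set (D i)) = E"
  using dist by (auto simp: distributes_def)

lemma distinct_D: "i < m \<Longrightarrow> distinct (D i)"
  and disjoint_D: "i < m \<Longrightarrow> j < m \<Longrightarrow> i \<noteq> j \<Longrightarrow> set (D i) \<inter> set (D j) = {}"
  using dist by (simp_all add: distributes_def distinct_concat_map_iff)

lemma D_slot:
  assumes "i < m" "p < length (D i)"
  shows "p * m + i < slots" "slot (p * m + i) = D i ! p"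
proof -
  have "length (D i) \<le> nat \<lceil>real (C * n) / real m\<rceil>"
    using dist assms(1) by (simp add: distributes_def)
  with assms(2) have "int p < \<lceil>real (C * n) / real m\<rceil>"
    by linarith
  then have "real p < real (C * n) / real m"
    by (simp add: less_ceiling_iff)
  then have "real (p * m) < real (C * n)"
    using m_pos by (simp add: field_simps)
  then have "p * m < C * n"
    by (simp only: of_nat_less_iff)
  then show "p * m + i < slots"
    using assms(1) m_le by (simp add: slots_def)
  show "slot (p * m + i) = D i ! p"
    using assms by (simp add: slot_def slot_pair_def)
qed

lemma slot_cases:
  obtains "slot w \<in> E" "w div m < length (D (w mod m))" "slot w = D (w mod m) ! (w div m)"
  | "slot w = (0, n + w)" "\<not> w div m < length (D (w mod m))"
proof (cases "w div m < length (D (w mod m))")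
  case True
  moreover have "w mod m < m" using m_pos by simp
  ultimately have "D (w mod m) ! (w div m) \<in> E"
    using set_D nth_mem by blast
  with True that(1) show ?thesis
    by (simp add: slot_def slot_pair_def)
qed (use that(2) in \<open>simp add: slot_def slot_pair_def\<close>)

lemma slot_less: "fst (slot w) < snd (slot w)"
  using E_subset n_pos by (cases w rule: slot_cases) auto

text \<open>Real edges occur once over all machines and have endpoints below \<open>n\<close>, while
  the dummy endpoint \<open>n + w\<close> identifies its slot.\<close>

lemma slot_eqD:
  assumes "slot w = slot w'"
  shows "w = w'"
proof (cases w rule: slot_cases)
  case 1
  note w = this
  have w': "w' div m < length (D (w' mod m))" "slot w' = D (w' mod m) ! (w' div m)"
    using w assms E_subset by (cases w' rule: slot_cases; auto)+
  have "w mod m < m" "w' mod m < m"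
    using m_pos by simp_all
  moreover have "slot w \<in> set (D (w mod m)) \<inter> set (D (w' mod m))"
    using w w' assms by (metis IntI nth_mem)
  ultimately have mods: "w mod m = w' mod m"
    using disjoint_D by blast
  then have "w div m = w' div m"
    using w w' assms distinct_D[OF \<open>w mod m < m\<close>] by (simp add: nth_eq_iff_index_eq)
  with mods show ?thesis
    by (metis div_mult_mod_eq)
next
  case 2
  then show ?thesis
    using assms E_subset by (cases w' rule: slot_cases) auto
qed

lemma index_simps:
  "i < n \<Longrightarrow> index i = (i, i)"
  "index (n + 2 * w) = slot w"
  "index (Suc (n + 2 * w)) = prod.swap (slot w)"
  by (simp_all add: index_def index_pair_def owner_def slot_def Suc_diff_le)

lemma index_cases:
  obtains "i < n" "index i = (i, i)"
  | w where "i = n + 2 * w" "index i = slot w"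
  | w where "i = Suc (n + 2 * w)" "index i = prod.swap (slot w)"
proof (cases "i < n")
  case False
  show ?thesis
  proof (cases "even (i - n)")
    case True
    then obtain w where "i - n = 2 * w" by blast
    then have "i = n + 2 * w" using False by simp
    with that(2) show ?thesis by (simp add: index_simps)
  next
    case odd: False
    then obtain w where "i - n = 2 * w + 1" using oddE by blast
    then have "i = Suc (n + 2 * w)" using False by simp
    with that(3) show ?thesis by (simp add: index_simps)
  qed
qed (use that(1) in \<open>simp add: index_simps\<close>)

text \<open>Vertices give diagonal pairs, the first point of a slot an increasing pair and the
  second a decreasing one; within one kind the index can be recovered. This makes the vectors of the
  instance distinct.\<close>

lemma inj_index: "inj index"
proof (rule injI)
  fix i i' assume eq: "index i = index i'"
  show "i = i'"
  proof (cases i rule: index_cases)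
    case i: 1
    show ?thesis
    proof (cases i' rule: index_cases)
      case (2 w') then show ?thesis using slot_less[of w'] i eq by (metis fst_conv snd_conv less_irrefl)
    next
      case (3 w') then show ?thesis using slot_less[of w'] i eq by (metis fst_conv snd_conv fst_swap snd_swap less_irrefl)
    qed (use i eq in simp)
  next
    case i: (2 w)
    show ?thesis
    proof (cases i' rule: index_cases)
      case 1 then show ?thesis using slot_less[of w] i eq by simp
    next
      case (2 w') then show ?thesis using slot_eqD[of w w'] i eq by simp
    next
      case (3 w') then show ?thesis using slot_less[of w] slot_less[of w'] i eq by simp
    qed
  next
    case i: (3 w)
    show ?thesis
    proof (cases i' rule: index_cases)
      case 1 then show ?thesis using slot_less[of w] i eq by (metis fst_conv snd_conv fst_swap snd_swap less_irrefl)
    next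
      case (2 w')
      then have "slot w' = prod.swap (slot w)" using i eq by simp
      then show ?thesis using slot_less[of w] slot_less[of w'] by simp
    next
      case (3 w') then show ?thesis using slot_eqD[of w w'] i eq by (simp add: prod_eq_iff)
    qed
  qed
qed

lemma padded_graph_index: "padded_graph n size E (index ` {..<size})"
proof
  show "0 < n" by (rule n_pos)
  show "E \<subseteq> {..<n} \<times> {..<n}"
    using E_subset by auto
  show "(u, u) \<in> index ` {..<size}" if "u < n" for u
    using that index_simps(1)[of u] by (intro image_eqI[of _ _ u]) auto
  have E_slot: "\<exists>w<slots. slot w = e" if e: "e \<in> E" for e
  proof -
    obtain i where i: "i < m" "e \<in> set (D i)"
      using e set_D by blast
    then obtain p where "p < length (D i)" "D i ! p = e"
      by (auto simp: in_set_conv_nth)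
    with D_slot[OF i(1)] show ?thesis by blast
  qed
  show "E \<subseteq> index ` {..<size}"
  proof
    fix e assume "e \<in> E"
    then obtain w where "w < slots" "slot w = e"
      using E_slot by blast
    then show "e \<in> index ` {..<size}"
      using index_simps(2)[of w] by (intro image_eqI[of _ _ "n + 2 * w"]) auto
  qed
  show "(y, x) \<in> index ` {..<size}" if xy: "(x, y) \<in> index ` {..<size}" for x y
  proof -
    obtain i where i: "i < size" "index i = (x, y)"
      using xy by auto
    show ?thesis
    proof (cases i rule: index_cases)
      case 1
      then show ?thesis using i xy by auto
    next
      case (2 w)
      then have "index (Suc (n + 2 * w)) = (y, x)" "Suc (n + 2 * w) < size"
        using i by (auto simp: index_simps)
      then show ?thesis by (metis imageI lessThan_iff)
    next
      case (3 w)
      then have "index (n + 2 * w) = (y, x)" "n + 2 * w < size"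
        using i by (auto simp: index_simps prod_eq_iff)
      then show ?thesis by (metis imageI lessThan_iff)
    qed
  qed
  \<comment> \<open>A dummy endpoint \<open>n + w\<close> is below \<open>n + slots\<close>, so a
    gadget with as many vectors as the instance has points is large enough.\<close>
  have slot_bound: "fst (slot w) < size" "snd (slot w) < size" if "w < slots" for w
    using that E_subset n_pos by (cases w rule: slot_cases; auto)+
  have "index i \<in> {..<size} \<times> {..<size}" if "i < size" for i
    using that slot_bound by (cases i rule: index_cases) (auto simp: mem_Times_iff)
  then show "index ` {..<size} \<subseteq> {..<size} \<times> {..<size}"
    by blast
  show "x < n \<and> x = y \<or> (x, y) \<in> E \<or> (y, x) \<in> E \<or> x = 0 \<and> n \<le> y \<or> y = 0 \<and> n \<le> x"
    if xy: "(x, y) \<in> index ` {..<size}" for x y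
  proof -
    obtain i where i: "index i = (x, y)"
      using xy by auto
    show ?thesis
    proof (cases i rule: index_cases)
      case 1
      then show ?thesis using i by auto
    next
      case (2 w)
      then show ?thesis using i by (cases w rule: slot_cases) auto
    next
      case (3 w)
      then have "slot w = (y, x)" using i by (simp add: prod_eq_iff)
      then show ?thesis by (cases w rule: slot_cases) auto
    qed
  qed
qed

end

section \<open>The clustering instance and its distribution\<close>

lemma set_vec_entries: "set (vec_entries d f i) = {(i, c, of_int (f c)) | c. c < d \<and> f c \<noteq> 0}"
  by (auto simp: vec_entries_def)

lemma distinct_vec_entries: "distinct (vec_entries d f i)"
  by (auto simp: vec_entries_def distinct_map inj_on_def)

lemma length_vec_entries: "length (vec_entries d f i) = card {c. c < d \<and> f c \<noteq> 0}"
proof -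
  have "length (vec_entries d f i) = card (set (filter (\<lambda>c. f c \<noteq> 0) [0..<d]))"
    unfolding vec_entries_def length_map by (rule distinct_card[symmetric]) simp
  then show ?thesis by (simp add: conj_commute)
qed

lemma sum_list_le_const_mult:
  fixes f :: "'a \<Rightarrow> nat"
  shows "(\<And>x. x \<in> set xs \<Longrightarrow> f x \<le> B) \<Longrightarrow> sum_list (map f xs) \<le> length xs * B"
  by (induction xs) (auto intro!: add_mono)

lemma length_le_sum_list:
  fixes f :: "'a \<Rightarrow> nat"
  shows "(\<And>x. x \<in> set xs \<Longrightarrow> 1 \<le> f x) \<Longrightarrow> length xs \<le> sum_list (map f xs)"
  using sum_list_mono[of xs "\<lambda>_. 1" f] by (simp add: sum_list_triv)

context distributed_graph
begin

definition vector :: "(nat \<Rightarrow> nat \<Rightarrow> int) \<Rightarrow> nat \<Rightarrow> nat \<Rightarrow> rat" where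
  "vector a i c = of_int (pair_vec a (index i) c)"

lemma index_less: "i < size \<Longrightarrow> fst (index i) < size \<and> snd (index i) < size"
  using padded_graph.R_less[OF padded_graph_index] by (auto simp: mem_Times_iff)

lemma machine_entries_D:
  "machine_entries n size m d a j (D j) =
     concat (map (\<lambda>i. vec_entries d (pair_vec a (index i)) i) (filter (\<lambda>i. owner n m i = j) [0..<size]))"
  unfolding machine_entries_def by (intro arg_cong[of _ _ concat] map_cong) (auto simp: index_def)

lemma three_n_le_size: "3 * n \<le> size"
  by (simp add: slots_def)

lemma length_owner_filter: "length (filter (\<lambda>i. owner n m i = j) [0..<size]) = card {i. i < size \<and> owner n m i = j}"
proof -
  have "length (filter (\<lambda>i. owner n m i = j) [0..<size]) = card (set (filter (\<lambda>i. owner n m i = j) [0..<size]))"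
    by (rule distinct_card[symmetric]) simp
  then show ?thesis by (simp add: conj_commute)
qed

context
  fixes \<rho> :: "rvec \<Rightarrow> rvec \<Rightarrow> real" and d k :: nat and \<gamma> \<theta> :: real and a :: "nat \<Rightarrow> nat \<Rightarrow> int"
  assumes G: "gadget \<rho> d k size \<gamma> \<theta> a"
begin

lemma vec_index:
  assumes "i < size"
  shows "d \<le> c \<Longrightarrow> pair_vec a (index i) c = 0" "\<bar>pair_vec a (index i) c\<bar> \<le> 3"
    "\<exists>c. pair_vec a (index i) c \<noteq> 0" "2 * card {c. pair_vec a (index i) c \<noteq> 0} \<le> k"
  using gadget_vec[OF G, of "fst (index i)" "snd (index i)"] index_less[OF assms] by simp_all

lemma length_vec_entries_index:
  assumes "i < size"
  shows "2 * length (vec_entries d (pair_vec a (index i)) i) \<le> k"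
    "1 \<le> length (vec_entries d (pair_vec a (index i)) i)"
proof -
  have eq: "{c. c < d \<and> pair_vec a (index i) c \<noteq> 0} = {c. pair_vec a (index i) c \<noteq> 0}"
    using vec_index(1)[OF assms] by (metis (lifting) linorder_not_le)
  show "2 * length (vec_entries d (pair_vec a (index i)) i) \<le> k"
    using vec_index(4)[OF assms] by (simp add: length_vec_entries eq)
  have "finite {c. c < d \<and> pair_vec a (index i) c \<noteq> 0}" by simp
  then show "1 \<le> length (vec_entries d (pair_vec a (index i)) i)"
    using vec_index(3)[OF assms] unfolding length_vec_entries eq by (simp add: Suc_le_eq card_gt_0_iff)
qed

text \<open>A machine owns at most size/m + 3 points, and 3m is at most \<open>size\<close>, so it
  exceeds the average by at most a factor 2. Each vector has at most k/2 entries, which compensates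
  for this.\<close>

lemma length_machine_entries_le:
  "length (machine_entries n size m d a j (D j)) \<le> nat \<lceil>real (size * k) / real m\<rceil>"
proof -
  let ?l = "length (machine_entries n size m d a j (D j))"
  have "2 * ?l = 2 * sum_list (map (\<lambda>i. length (vec_entries d (pair_vec a (index i)) i))
      (filter (\<lambda>i. owner n m i = j) [0..<size]))"
    unfolding machine_entries_D by (simp add: length_concat o_def)
  also have "\<dots> = sum_list (map (\<lambda>i. 2 * length (vec_entries d (pair_vec a (index i)) i))
      (filter (\<lambda>i. owner n m i = j) [0..<size]))"
    by (simp add: sum_list_const_mult)
  also have "\<dots> \<le> card {i. i < size \<and> owner n m i = j} * k"
    unfolding length_owner_filter[symmetric]
    by (rule sum_list_le_const_mult) (use length_vec_entries_index(1) in auto)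
  finally have "m * (2 * ?l) \<le> m * (card {i. i < size \<and> owner n m i = j} * k)"
    by (rule mult_le_mono2)
  also have "\<dots> = m * card {i. i < size \<and> owner n m i = j} * k"
    by simp
  also have "\<dots> \<le> (size + 3 * m) * k"
    by (intro mult_le_mono1 card_owner_le m_pos)
  also have "\<dots> \<le> (size + size) * k"
    using three_n_le_size m_le by (intro mult_le_mono1 add_left_mono) linarith
  finally have "m * ?l \<le> size * k" by (simp add: add_mult_distrib)
  then have "real (m * ?l) \<le> real (size * k)"
    by (rule of_nat_mono)
  then have "real ?l \<le> real (size * k) / real m"
    using m_pos by (simp add: field_simps)
  then show ?thesis by linarith
qed

text \<open>Every edge yields a point on its own machine, and this point has a non-zero entry. Hence
  the raw edges fit wherever the entries fit.\<close>

lemma length_D_le: 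
  assumes "j < m"
  shows "length (D j) \<le> length (machine_entries n size m d a j (D j))"
proof -
  let ?f = "\<lambda>p. n + 2 * (p * m + j)"
  have "?f ` {..<length (D j)} \<subseteq> {i. i < size \<and> owner n m i = j}"
  proof (rule image_subsetI)
    fix p assume "p \<in> {..<length (D j)}"
    then have "p * m + j < slots"
      using D_slot(1)[OF assms] by simp
    then show "?f p \<in> {i. i < size \<and> owner n m i = j}"
      using assms by (simp add: owner_def)
  qed
  then have "card (?f ` {..<length (D j)}) \<le> card {i. i < size \<and> owner n m i = j}"
    by (rule card_mono[rotated]) simp
  also have "card (?f ` {..<length (D j)}) = length (D j)"
    using m_pos by (subst card_image) (auto simp: inj_on_def)
  also have "card {i. i < size \<and> owner n m i = j} \<le> sum_list (map (\<lambda>i. length (vec_entries d (pair_vec a (index i)) i))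
      (filter (\<lambda>i. owner n m i = j) [0..<size]))"
    unfolding length_owner_filter[symmetric]
    by (rule length_le_sum_list) (use length_vec_entries_index(2) in auto)
  also have "\<dots> = length (machine_entries n size m d a j (D j))"
    unfolding machine_entries_D by (simp add: length_concat o_def)
  finally show ?thesis .
qed

lemma distributes_entries:
  "distributes m (size * k) (entries size (vector a)) (\<lambda>j. machine_entries n size m d a j (D j))"
  unfolding distributes_def
proof (intro conjI allI impI length_machine_entries_le)
  have set_machine: "set (machine_entries n size m d a j (D j)) =
      {(i, c, vector a i c) | i c. i < size \<and> owner n m i = j \<and> c < d \<and> vector a i c \<noteq> 0}" for j
    unfolding machine_entries_D by (auto simp: set_vec_entries vector_def)
  have "distinct (machine_entries n size m d a j (D j))" for j
    unfolding machine_entries_D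
    by (subst distinct_concat_map_iff) (auto simp: distinct_vec_entries set_vec_entries)
  then show "distinct (concat (map (\<lambda>j. machine_entries n size m d a j (D j)) [0..<m]))"
    by (subst distinct_concat_map_iff) (auto simp: set_machine)
  have "owner n m i < m" for i
    using m_pos by (simp add: owner_def)
  moreover have "c < d" if "i < size" "vector a i c \<noteq> 0" for i c
    using vec_index(1)[OF that(1), of c] that(2) by (auto simp: vector_def intro: leI)
  ultimately show "set (concat (map (\<lambda>j. machine_entries n size m d a j (D j)) [0..<m])) =
      entries size (vector a)"
    by (auto simp: set_machine entries_def)
qed

lemma slc_instance_vector:
  assumes "1 \<le> b"
  shows "slc_instance b d k size (vector a)"
  unfolding slc_instance_def
proof (intro conjI allI impI)
  show "inj_on (vector a) {..<size}"
  proof (rule inj_onI)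
    fix i i' assume ii: "i \<in> {..<size}" "i' \<in> {..<size}" and eq: "vector a i = vector a i'"
    have "pair_vec a (index i) = pair_vec a (index i')"
      using fun_cong[OF eq] by (auto simp: vector_def)
    moreover have "index i \<in> {..<size} \<times> {..<size}" "index i' \<in> {..<size} \<times> {..<size}"
      using index_less ii by (auto simp: mem_Times_iff)
    ultimately have "index i = index i'"
      using gadget_inj[OF G] by (meson inj_onD)
    then show "i = i'"
      using inj_index by (simp add: inj_eq)
  qed
  fix i assume i: "i < size"
  show "vector a i j = 0" if "d \<le> j" for j
    using vec_index(1)[OF i that] by (simp add: vector_def)
  show "card {j. vector a i j \<noteq> 0} \<le> k"
    using vec_index(4)[OF i] by (simp add: vector_def)
  have "3 \<le> size"
    using three_n_le_size n_pos by linarith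
  also have "\<dots> \<le> size ^ b"
    using assms n_pos by (intro self_le_power) auto
  finally have "int 3 \<le> int (size ^ b)"
    by (rule of_nat_mono)
  then have size: "3 \<le> int (size ^ b)" by simp
  fix j
  show "\<bar>fst (quotient_of (vector a i j))\<bar> \<le> int (size ^ b)"
    "snd (quotient_of (vector a i j)) \<le> int (size ^ b)"
    using order_trans[OF vec_index(2)[OF i, of j] size] size by (simp_all add: vector_def)
qed

lemma vector_image:
  "(\<lambda>i j. real_of_rat (vector a i j)) ` {..<size} =
     (\<lambda>p. real_vec (pair_vec a p)) ` (index ` {..<size})"
  unfolding image_image by (intro image_cong refl) (simp add: vector_def real_vec_def fun_eq_iff)

text \<open>On a connected graph the output is at most the optimum, hence at most
  \<open>\<theta>\<close>. On a disconnected one an output up to \<open>\<theta>\<close> would give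
  \<open>\<gamma> * \<theta> \<le> \<beta> * \<theta>\<close>, against
  \<open>\<beta> < \<gamma>\<close>.\<close>

lemma approximation_decides_connectivity:
  assumes "1 \<le> \<beta>" "\<beta> < \<gamma>"
    and x: "x \<in> approximations \<beta> (slc2 \<rho> ((\<lambda>i j. real_of_rat (vector a i j)) ` {..<size}))"
  shows "x \<le> \<theta> \<longleftrightarrow> connected_graph n E"
proof
  interpret padded_graph n size E "index ` {..<size}"
    by (rule padded_graph_index)
  have "card (index ` {..<size}) = size"
    using inj_index by (simp add: card_image inj_on_def)
  moreover have "1 < size"
    using three_n_le_size n_pos by linarith
  ultimately have big: "1 < card (index ` {..<size})" by simp
  show "x \<le> \<theta>" if "connected_graph n E"
    using slc2_connected[OF G that big] x unfolding vector_image approximations_def by simp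
  show "connected_graph n E" if "x \<le> \<theta>"
  proof (rule ccontr)
    assume "\<not> connected_graph n E"
    from slc2_disconnected[OF G this] have "\<gamma> * \<theta> \<le> \<beta> * x"
      using x unfolding vector_image approximations_def by simp
    also have "\<dots> \<le> \<beta> * \<theta>"
      using assms(1) that by (intro mult_left_mono) auto
    also have "\<dots> < \<gamma> * \<theta>"
      using assms(2) gadget_pos[OF G] by (intro mult_strict_right_mono)
    finally show False by simp
  qed
qed

end

end

section \<open>Correctness of the reduction for fixed n\<close>

definition graph_reduction ::
  "nat \<Rightarrow> nat \<Rightarrow> nat \<Rightarrow> (nat \<Rightarrow> nat \<Rightarrow> int) \<Rightarrow> real \<Rightarrow> real mpc \<Rightarrow> bool mpc" where
  "graph_reduction n n' d a \<theta> A =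
     preprocess
       (\<lambda>j x. concat (map enc_entry (machine_entries n n' (machines A) d a j (decode_edges x))))
       (\<lambda>x. x \<le> \<theta>) A"

lemma length_concat_map_const:
  "(\<And>x. length (f x) = c) \<Longrightarrow> length (concat (map f xs)) = c * length xs"
  by (induction xs) auto

text \<open>The constructed instance depends on the distribution \<open>D\<close> and not just on
  the graph, since slots follow positions in the lists. Therefore \<open>A\<close> is assumed
  correct on all instances.\<close>

lemma correct_on_graph_reduction:
  assumes n': "n' = (2 * C + 3) * n"
    and m: "0 < machines A" "machines A \<le> n"
    and G: "gadget \<rho> d k n' \<gamma> \<theta> a"
    and A: "\<And>v. slc_instance b d k n' v \<Longrightarrow> correct_on A s W (n' * k) enc_entry (entries n' v)
          (approximations \<beta> (slc2 \<rho> ((\<lambda>i j. real_of_rat (v i j)) ` {..<n'})))"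
    and \<beta>: "1 \<le> \<beta>" "\<beta> < \<gamma>" and b: "1 \<le> b"
    and W': "W \<le> W'" "n \<le> W'"
    and E: "E \<subseteq> {(u, v). u < v \<and> v < n}"
  shows "correct_on (graph_reduction n n' d a \<theta> A) s W' (C * n) enc_edge E {connected_graph n E}"
  unfolding correct_on_def Let_def
proof (intro allI impI)
  fix D assume D: "distributes (machines (graph_reduction n n' d a \<theta> A)) (C * n) E D"
  define m where "m = machines A"
  interpret distributed_graph n m C E D
    using D m E by unfold_locales (simp_all add: graph_reduction_def m_def)
  have size: "size = n'"
    by (simp add: slots_def n' algebra_simps)
  note G = G[folded size]
  define M where "M i = concat (map enc_edge (D i))" for i
  define f where "f j x = concat (map enc_entry (machine_entries n size m d a j (decode_edges x)))" for j x
  have f_M: "f j (M j) = concat (map enc_entry (machine_entries n size m d a j (D j)))" for j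
    by (simp add: f_def M_def)
  have "correct_on A s W (size * k) enc_entry (entries size (vector a))
      (approximations \<beta> (slc2 \<rho> ((\<lambda>i j. real_of_rat (vector a i j)) ` {..<size})))"
    using A[folded size] slc_instance_vector[OF G b] by blast
  with distributes_entries[OF G] have limits: "within_limits A s W (\<lambda>j. f j (M j))"
    and res: "result A (memory A (\<lambda>j. f j (M j)) (rounds A) 0) \<in>
      approximations \<beta> (slc2 \<rho> ((\<lambda>i j. real_of_rat (vector a i j)) ` {..<size}))"
    unfolding correct_on_def Let_def f_M m_def by blast+
  have red: "graph_reduction n n' d a \<theta> A = preprocess f (\<lambda>x. x \<le> \<theta>) A"
    unfolding graph_reduction_def f_def size m_def ..
  have "within_limits (preprocess f (\<lambda>x. x \<le> \<theta>) A) s W' M"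
  proof (rule within_limits_preprocess[where f = f and M = M, OF limits _ _ W'(1)])
    fix j assume "j < machines A"
    then have j: "j < m" by (simp add: m_def)
    have "length (M j) = 2 * length (D j)"
      unfolding M_def by (rule length_concat_map_const) (simp add: enc_edge_def)
    \<comment> \<open>An edge is encoded by two words and an entry by four.\<close>
    also have "\<dots> \<le> 4 * length (machine_entries n size m d a j (D j))"
      using length_D_le[OF G j] by linarith
    also have "\<dots> = length (f j (M j))"
      unfolding f_M by (rule length_concat_map_const[symmetric]) (simp add: enc_entry_def split: prod.splits)
    also have "\<dots> \<le> s"
      using limits \<open>j < machines A\<close> unfolding within_limits_def by (metis memory.simps(1) le0)
    finally show "length (M j) \<le> s" .
    fix x assume "x \<in> set (M j)"
    then obtain e where "e \<in> set (D j)" "x = int (fst e) \<or> x = int (snd e)"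
      by (auto simp: M_def enc_edge_def)
    moreover from this have "e \<in> E" using set_D j by blast
    ultimately show "\<bar>x\<bar> \<le> int W'"
      using E W'(2) by auto
  qed
  moreover have "result (preprocess f (\<lambda>x. x \<le> \<theta>) A)
      (memory (preprocess f (\<lambda>x. x \<le> \<theta>) A) M (rounds (preprocess f (\<lambda>x. x \<le> \<theta>) A)) 0) =
      connected_graph n E"
    using approximation_decides_connectivity[OF G \<beta> res]
    by (simp add: memory_preprocess del: memory.simps(2))
  ultimately show "within_limits (graph_reduction n n' d a \<theta> A) s W' (\<lambda>i. concat (map enc_edge (D i))) \<and>
      result (graph_reduction n n' d a \<theta> A)
        (memory (graph_reduction n n' d a \<theta> A) (\<lambda>i. concat (map enc_edge (D i)))
          (rounds (graph_reduction n n' d a \<theta> A)) 0) \<in> {connected_graph n E}"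
    unfolding red M_def[abs_def] by simp
qed

section \<open>Asymptotics\<close>

lemma filterlim_mult_const_nat: "0 < L \<Longrightarrow> filterlim (\<lambda>n::nat. L * n) at_top at_top"
  by (rule filterlim_subseq) (simp add: strict_mono_def)

lemma ln_mult_const_bigo:
  assumes "0 < L"
  shows "(\<lambda>n::nat. ln (real (L * n))) \<in> O(\<lambda>n. ln (real n))"
  using assms by real_asymp

text \<open>The local memory is a positive power of n and outweighs the polylogarithmic factor in
  the total memory. This provides \<open>m \<le> n\<close>, on which the slot layout relies.\<close>

lemma machines_smallo:
  assumes s: "(\<lambda>n. real (s n)) \<in> \<Theta>(\<lambda>n. real n powr \<alpha>)" and "0 < \<alpha>"
    and total: "(\<lambda>n. real (m n * s n)) \<in> O(\<lambda>n. real n * ln (real n) ^ p)"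
  shows "(\<lambda>n. real (m n)) \<in> o(\<lambda>n. real n)"
proof -
  have "(\<lambda>n. real (m n) * real (s n)) \<in> O(\<lambda>n. real n * ln (real n) ^ p)"
    using total by simp
  also have "(\<lambda>n. real n * ln (real n) ^ p) \<in> o(\<lambda>n. real n * real n powr \<alpha>)"
    using \<open>0 < \<alpha>\<close> by (intro landau_o.small.mult_left) real_asymp
  finally show ?thesis
    by (subst (asm) landau_o.small.mult_cancel_right[OF s])
       (use eventually_gt_at_top[of 0] in \<open>auto elim!: eventually_mono\<close>)
qed

text \<open>On n vertices the program for L * n points is run. The constant factor L changes local
  memory, total memory and the logarithm only by constants.\<close>

lemma connectivity_from_slc_approximation:
  fixes P :: "(nat \<times> nat, bool) problem"
  assumes \<alpha>: "0 < \<alpha>"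
    and P: "\<And>n X Y. (X, Y) \<in> P n \<Longrightarrow> X \<subseteq> {(u, v). u < v \<and> v < n} \<and> Y = {connected_graph n X}"
    and C: "1 \<le> C"
    and k: "soft_O (\<lambda>n. real (k n)) (\<lambda>n. 1)"
    and gad: "\<forall>\<^sub>F n in sequentially. \<exists>\<theta> a. gadget (\<rho> (d n)) (d n) (k n) n \<gamma> \<theta> a"
    and \<beta>: "\<And>n. 1 \<le> \<beta> n \<and> \<beta> n < \<gamma>" and b: "1 \<le> b"
    and A: "mpc_algorithm \<alpha> (\<lambda>n. n * k n) enc_entry (slc_problem \<rho> \<beta> b d k) A"
    and rounds_A: "(\<lambda>n. real (rounds (A n))) \<in> o(\<lambda>n. ln (real n))"
  shows "\<exists>B. mpc_algorithm \<alpha> (\<lambda>n. C * n) enc_edge P B \<and>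
           (\<lambda>n. real (rounds (B n))) \<in> o(\<lambda>n. ln (real n))"
proof -
  obtain s c where s: "(\<lambda>n. real (s n)) \<in> \<Theta>(\<lambda>n. real n powr \<alpha>)"
    and total: "soft_O (\<lambda>n. real (machines (A n) * s n)) (\<lambda>n. real (n * k n))"
    and correct: "\<forall>\<^sub>F n in sequentially. 0 < machines (A n) \<and>
      (\<forall>(X, Y)\<in>slc_problem \<rho> \<beta> b d k n. correct_on (A n) (s n) (n ^ c) (n * k n) enc_entry X Y)"
    using A unfolding mpc_algorithm_def by blast
  obtain p where p: "(\<lambda>n. real (machines (A n) * s n)) \<in> O(\<lambda>n. real (n * k n) * ln (real n) ^ p)"
    using total unfolding soft_O_def by blast
  obtain q where q: "(\<lambda>n. real (k n)) \<in> O(\<lambda>n. 1 * ln (real n) ^ q)"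
    using k unfolding soft_O_def by blast
  \<comment> \<open>As \<open>k\<close> is polylogarithmic, the clustering input has the same size
    as the graph up to such factors.\<close>
  have "(\<lambda>n. real (n * k n) * ln (real n) ^ p) \<in> O(\<lambda>n. real n * (1 * ln (real n) ^ q) * ln (real n) ^ p)"
    unfolding of_nat_mult by (intro landau_o.big.mult_right landau_o.big.mult_left q)
  with p have "(\<lambda>n. real (machines (A n) * s n)) \<in> O(\<lambda>n. real n * (1 * ln (real n) ^ q) * ln (real n) ^ p)"
    by (rule landau_o.big_trans)
  then have total': "(\<lambda>n. real (machines (A n) * s n)) \<in> O(\<lambda>n. real n * ln (real n) ^ (p + q))"
    by (simp add: power_add mult_ac)
  have m_small: "(\<lambda>n. real (machines (A n))) \<in> o(\<lambda>n. real n)"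
    by (rule machines_smallo[OF s \<alpha> total'])
  \<comment> \<open>There are n vertices and two points for each of the (C + 1) * n slots.\<close>
  define L where "L = 2 * C + 3"
  have L: "0 < L" by (simp add: L_def)
  note lim = filterlim_mult_const_nat[OF L]
  obtain \<theta> a where gad': "\<forall>\<^sub>F n in sequentially. gadget (\<rho> (d n)) (d n) (k n) n \<gamma> (\<theta> n) (a n)"
  proof -
    have "\<forall>n. \<exists>t. (\<exists>\<theta> a. gadget (\<rho> (d n)) (d n) (k n) n \<gamma> \<theta> a) \<longrightarrow>
        gadget (\<rho> (d n)) (d n) (k n) n \<gamma> (fst t) (snd t)"
      by auto
    then obtain t where "\<And>n. (\<exists>\<theta> a. gadget (\<rho> (d n)) (d n) (k n) n \<gamma> \<theta> a) \<Longrightarrow>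
        gadget (\<rho> (d n)) (d n) (k n) n \<gamma> (fst (t n)) (snd (t n))"
      by metis
    with gad have "\<forall>\<^sub>F n in sequentially. gadget (\<rho> (d n)) (d n) (k n) n \<gamma> (fst (t n)) (snd (t n))"
      by (rule eventually_mono)
    then show ?thesis
      using that[of "\<lambda>n. fst (t n)" "\<lambda>n. snd (t n)"] by simp
  qed
  define B where "B n = graph_reduction n (L * n) (d (L * n)) (a (L * n)) (\<theta> (L * n)) (A (L * n))" for n
  have "(\<lambda>n. real (s (L * n))) \<in> \<Theta>(\<lambda>n. real (L * n) powr \<alpha>)"
    using landau_theta.compose[OF s lim] .
  also have "(\<lambda>n. real (L * n) powr \<alpha>) \<in> \<Theta>(\<lambda>n. real n powr \<alpha>)"
    using L by (simp add: powr_mult)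
  finally have s_B: "(\<lambda>n. real (s (L * n))) \<in> \<Theta>(\<lambda>n. real n powr \<alpha>)" .
  have "(\<lambda>n. real (machines (A (L * n)) * s (L * n))) \<in> O(\<lambda>n. real (L * n) * ln (real (L * n)) ^ (p + q))"
    using landau_o.big.compose[OF total' lim] .
  also have "(\<lambda>n. real (L * n) * ln (real (L * n)) ^ (p + q)) \<in> O(\<lambda>n. real (C * n) * ln (real n) ^ (p + q))"
  proof (intro landau_o.big.mult landau_o.big_power ln_mult_const_bigo L)
    show "(\<lambda>n. real (L * n)) \<in> O(\<lambda>n. real (C * n))"
      using C L by simp
  qed
  finally have total_B: "soft_O (\<lambda>n. real (machines (B n) * s (L * n))) (\<lambda>n. real (C * n))"
    unfolding soft_O_def B_def by (auto simp: graph_reduction_def)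
  have "\<forall>\<^sub>F n in sequentially. real (machines (A n)) \<le> 1 / real L * real n"
    using landau_o.smallD[OF m_small, of "1 / real L"] L by simp
  then have "\<forall>\<^sub>F n in sequentially. real (machines (A (L * n))) \<le> 1 / real L * real (L * n)"
    using lim by (rule eventually_compose_filterlim)
  then have m_le: "\<forall>\<^sub>F n in sequentially. machines (A (L * n)) \<le> n"
    using L by (auto elim!: eventually_mono)
  have "\<forall>\<^sub>F n in sequentially. 0 < machines (B n) \<and>
      (\<forall>(X, Y)\<in>P n. correct_on (B n) (s (L * n)) (n ^ (2 * c + 1)) (C * n) enc_edge X Y)"
    using m_le eventually_compose_filterlim[OF correct lim] eventually_compose_filterlim[OF gad' lim]
      eventually_ge_at_top[of "L + 1"]
  proof eventually_elim
    case (elim n)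
    have n: "L \<le> n" "1 \<le> n" using elim(4) by auto
    \<comment> \<open>With \<open>L \<le> n\<close> the word bound becomes a power of
      \<open>n\<close>. The exponent \<open>2 * c + 1\<close> makes it at least \<open>n\<close>
      even for \<open>c = 0\<close>, as the raw vertex numbers require.\<close>
    have W: "(L * n) ^ c \<le> n ^ (2 * c + 1)"
    proof -
      have "(L * n) ^ c \<le> (n * n) ^ c"
        using n by (intro power_mono mult_le_mono1) auto
      also have "\<dots> = n ^ (2 * c)"
        by (simp add: power_mult power2_eq_square)
      also have "\<dots> \<le> n ^ (2 * c + 1)"
        using n by (intro power_increasing) auto
      finally show ?thesis .
    qed
    have W': "n \<le> n ^ (2 * c + 1)"
      using n by (intro self_le_power) auto
    have slc: "correct_on (A (L * n)) (s (L * n)) ((L * n) ^ c) (L * n * k (L * n)) enc_entry (entries (L * n) v)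
        (approximations (\<beta> (L * n)) (slc2 (\<rho> (d (L * n))) ((\<lambda>i j. real_of_rat (v i j)) ` {..<L * n})))"
      if "slc_instance b (d (L * n)) (k (L * n)) (L * n) v" for v
    proof -
      have "(entries (L * n) v,
          approximations (\<beta> (L * n)) (slc2 (\<rho> (d (L * n))) ((\<lambda>i j. real_of_rat (v i j)) ` {..<L * n})))
          \<in> slc_problem \<rho> \<beta> b d k (L * n)"
        using that unfolding slc_problem_def by blast
      with elim(2) show ?thesis by blast
    qed
    have "correct_on (B n) (s (L * n)) (n ^ (2 * c + 1)) (C * n) enc_edge X Y" if "(X, Y) \<in> P n" for X Y
    proof -
      have X: "X \<subseteq> {(u, v). u < v \<and> v < n}" and Y: "Y = {connected_graph n X}"
        using P[OF that] by auto
      show ?thesis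
        unfolding B_def Y
        by (rule correct_on_graph_reduction[OF _ _ elim(1) elim(3) slc _ _ b W W' X])
           (use elim(2) \<beta> in \<open>auto simp: L_def\<close>)
    qed
    moreover have "0 < machines (B n)"
      using elim(2) by (simp add: B_def graph_reduction_def)
    ultimately show ?case by blast
  qed
  with s_B total_B have "mpc_algorithm \<alpha> (\<lambda>n. C * n) enc_edge P B"
    unfolding mpc_algorithm_def by (intro exI[of _ "\<lambda>n. s (L * n)"] exI[of _ "2 * c + 1"]) simp
  moreover have "(\<lambda>n. real (rounds (B n))) \<in> o(\<lambda>n. ln (real n))"
  proof -
    have "(\<lambda>n. real (rounds (A (L * n)))) \<in> o(\<lambda>n. ln (real (L * n)))"
      using landau_o.small.compose[OF rounds_A lim] .
    then have "(\<lambda>n. real (rounds (A (L * n)))) \<in> o(\<lambda>n. ln (real n))"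
      using ln_mult_const_bigo[OF L] by (rule landau_o.small_big_trans)
    \<comment> \<open>The additional preprocessing round is absorbed.\<close>
    moreover have "(\<lambda>n::nat. 1::real) \<in> o(\<lambda>n. ln (real n))"
      by real_asymp
    ultimately have "(\<lambda>n. real (rounds (A (L * n))) + 1) \<in> o(\<lambda>n. ln (real n))"
      by (rule sum_in_smallo)
    then show ?thesis
      by (simp add: B_def graph_reduction_def add.commute)
  qed
  ultimately show ?thesis by blast
qed

section \<open>Hardness of connectivity from either conjecture\<close>

text \<open>A common consequence of both conjectures, with \<open>P\<close> any restriction of
  connectivity. It only excludes o(log n), because the cycle conjecture gives a lower bound along
  even n alone.\<close>

definition connectivity_hard :: "real \<Rightarrow> bool" where
  "connectivity_hard \<alpha> \<longleftrightarrow> (\<exists>C\<ge>1. \<exists>P.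
     (\<forall>n. \<forall>(X, Y)\<in>P n. X \<subseteq> {(u, v). u < v \<and> v < n} \<and> Y = {connected_graph n X}) \<and>
     (\<forall>A. mpc_algorithm \<alpha> (\<lambda>n. C * n) enc_edge P A \<longrightarrow>
        (\<lambda>n. real (rounds (A n))) \<notin> o(\<lambda>n. ln (real n))))"

lemma connectivity_hard_sparse:
  assumes sparse_connectivity_conjecture "\<alpha> \<in> {0<..<1}"
  shows "connectivity_hard \<alpha>"
proof -
  obtain C where C: "1 \<le> C"
    and hard: "\<And>A. mpc_algorithm \<alpha> (\<lambda>n. C * n) enc_edge (connectivity_problem C) A \<Longrightarrow>
        (\<lambda>n. real (rounds (A n))) \<in> \<Omega>(\<lambda>n. ln (real n))"
    using assms unfolding sparse_connectivity_conjecture_def by blast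
  \<comment> \<open>A function that is both Omega and o of the logarithm would force the logarithm
    to vanish eventually.\<close>
  have nz: "\<not> (\<forall>\<^sub>F n in sequentially. ln (real n) = 0)"
  proof
    assume "\<forall>\<^sub>F n in sequentially. ln (real n) = 0"
    with eventually_gt_at_top[of 1] have "\<forall>\<^sub>F n :: nat in sequentially. False"
      by eventually_elim simp
    then show False by simp
  qed
  have "(\<lambda>n. real (rounds (A n))) \<notin> o(\<lambda>n. ln (real n))"
    if "mpc_algorithm \<alpha> (\<lambda>n. C * n) enc_edge (connectivity_problem C) A" for A
    using landau_o.big_small_asymmetric[OF hard[OF that, unfolded bigomega_iff_bigo]] nz by blast
  moreover have "\<forall>n. \<forall>(X, Y)\<in>connectivity_problem C n.
      X \<subseteq> {(u, v). u < v \<and> v < n} \<and> Y = {connected_graph n X}"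
    by (auto simp: connectivity_problem_def)
  ultimately show ?thesis
    using C unfolding connectivity_hard_def by blast
qed

lemma connectivity_hard_cycle:
  assumes one_cycle_vs_two_cycles_conjecture "\<alpha> \<in> {0<..<1}"
  shows "connectivity_hard \<alpha>"
proof -
  have hard: "(\<lambda>k. real (rounds (A (2 * k)))) \<in> \<Omega>(\<lambda>k. ln (real (2 * k)))"
    if "mpc_algorithm \<alpha> (\<lambda>n. 1 * n) enc_edge cycle_problem A" for A
    using assms that unfolding one_cycle_vs_two_cycles_conjecture_def by simp
  have nz: "\<not> (\<forall>\<^sub>F k :: nat in sequentially. ln (real (2 * k)) = 0)"
  proof
    assume "\<forall>\<^sub>F k :: nat in sequentially. ln (real (2 * k)) = 0"
    with eventually_gt_at_top[of 1] have "\<forall>\<^sub>F k :: nat in sequentially. False"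
      by eventually_elim simp
    then show False by simp
  qed
  have fast: "(\<lambda>n. real (rounds (A n))) \<notin> o(\<lambda>n. ln (real n))"
    if A: "mpc_algorithm \<alpha> (\<lambda>n. 1 * n) enc_edge cycle_problem A" for A
  proof
    assume "(\<lambda>n. real (rounds (A n))) \<in> o(\<lambda>n. ln (real n))"
    then have "(\<lambda>k. real (rounds (A (2 * k)))) \<in> o(\<lambda>k. ln (real (2 * k)))"
      using filterlim_mult_const_nat[of 2] landau_o.small.compose by force
    with landau_o.big_small_asymmetric[OF hard[OF A, unfolded bigomega_iff_bigo]] nz show False
      by blast
  qed
  have "\<forall>n. \<forall>(X, Y)\<in>cycle_problem n.
      X \<subseteq> {(u, v). u < v \<and> v < n} \<and> Y = {connected_graph n X}"
    using cycle_problem_connectivity by blast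
  with fast show ?thesis
    unfolding connectivity_hard_def using le_refl[of "1::nat"] by blast
qed

lemma no_fast_slc_approximation_if_gadget:
  assumes "connectivity_hard \<alpha>" "0 < \<alpha>" "soft_O (\<lambda>n. real (k n)) (\<lambda>n. 1)"
    and "\<forall>\<^sub>F n in sequentially. \<exists>\<theta> a. gadget (\<rho> (d n)) (d n) (k n) n \<gamma>' \<theta> a" "\<gamma> \<le> \<gamma>'"
  shows "no_fast_slc_approximation \<alpha> \<rho> \<gamma> d k"
  unfolding no_fast_slc_approximation_def
proof (rule notI, elim exE conjE)
  fix A \<beta> and b :: nat
  assume \<beta>: "\<forall>n. 1 \<le> \<beta> n \<and> \<beta> n < \<gamma>" and b: "1 \<le> b"
    and A: "mpc_algorithm \<alpha> (\<lambda>n. n * k n) enc_entry (slc_problem \<rho> \<beta> b d k) A"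
      "(\<lambda>n. real (rounds (A n))) \<in> o(\<lambda>n. ln (real n))"
  obtain C P where C: "1 \<le> C"
    and P: "\<forall>n. \<forall>(X, Y)\<in>P n. X \<subseteq> {(u, v). u < v \<and> v < n} \<and> Y = {connected_graph n X}"
    and hard: "\<And>A. mpc_algorithm \<alpha> (\<lambda>n. C * n) enc_edge P A \<Longrightarrow>
        (\<lambda>n. real (rounds (A n))) \<notin> o(\<lambda>n. ln (real n))"
    using assms(1) unfolding connectivity_hard_def by blast
  have "1 \<le> \<beta> n \<and> \<beta> n < \<gamma>'" for n
    using \<beta> assms(5) by (meson less_le_trans)
  from connectivity_from_slc_approximation[OF assms(2) _ C assms(3,4) this b A, of P]
  show False using P hard by blast
qed

section \<open>Parameters for which gadgets exist\<close>

text \<open>The requirement is ln(2n) < (k div 2)/576. Here k div 2 is at least 2000 ln n - 1/2,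
  while 576 ln(2n) is at most 1152 ln n. For \<open>\<epsilon> \<le> 1\<close> the division by its
  square only enlarges \<open>k\<close>.\<close>

lemma eventually_gadget_l2:
  assumes "\<forall>\<^sub>F n in sequentially. 4000 * ln (real n) / \<epsilon>\<^sup>2 \<le> real (k n) \<and> k n \<le> d n"
    and "0 < \<epsilon>" "\<epsilon> \<le> 1"
  shows "\<forall>\<^sub>F n in sequentially. \<exists>\<theta> a. gadget (l2_dist (d n)) (d n) (k n) n (sqrt (7/2)) \<theta> a"
  using assms(1) eventually_ge_at_top[of 3]
proof eventually_elim
  case (elim n)
  have ln2: "1/2 \<le> ln (2::real)" "ln (2::real) \<le> ln (real n)"
    using elim ln2_ge_two_thirds by auto
  have "4000 * ln (real n) \<le> 4000 * ln (real n) / \<epsilon>\<^sup>2"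
  proof -
    have "\<epsilon>\<^sup>2 \<le> 1" "0 < \<epsilon>\<^sup>2" using assms(2,3) by (auto simp: power_le_one)
    then show ?thesis using ln2 by (simp add: le_divide_eq mult_left_le)
  qed
  then have k: "4000 * ln (real n) \<le> real (k n)"
    using elim by linarith
  have half: "real (k n) / 2 - 1/2 \<le> real (k n div 2)"
    by linarith
  have "ln (2 * real n) = ln 2 + ln (real n)"
    using elim by (simp add: ln_mult)
  then have "ln (2 * real n) < real (k n div 2) / 576"
    using k half ln2 by linarith
  then have "2 * real n < exp (real (k n div 2) / 576)"
    using elim by (metis exp_less_cancel_iff exp_ln mult_pos_pos of_nat_0_less_iff zero_less_numeral less_le_trans)
  then have "real n * (2 * exp (- real (k n div 2) / 576)) < 1"
    by (simp add: exp_minus field_simps)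
  moreover have "2 \<le> k n"
    using k ln2 by linarith
  ultimately show ?case
    using gadget_l2 elim by blast
qed

lemma eventually_gadget_l1:
  assumes "\<forall>\<^sub>F n in sequentially. 1 * real n \<le> real (d n)" "4 \<le> k"
  shows "\<forall>\<^sub>F n in sequentially. \<exists>\<theta> a. gadget (l1_dist (d n)) (d n) k n 3 \<theta> a"
  using assms(1)
proof eventually_elim
  case (elim n)
  then show ?case using gadget_l1[of n "d n" k] assms(2) by auto
qed

lemma soft_O_const: "soft_O (\<lambda>n. real k) (\<lambda>n. 1)"
  unfolding soft_O_def by (rule exI[of _ 0]) simp

lemma no_fast_slc_approximation_l1:
  assumes "\<And>\<alpha>. \<alpha> \<in> {0<..<1} \<Longrightarrow> connectivity_hard \<alpha>" "\<gamma> \<le> 3"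
  shows "\<exists>K>0. \<exists>k\<^sub>0::nat. \<forall>\<alpha>\<in>{0<..<1}. \<forall>(d::nat \<Rightarrow> nat). \<forall>k\<ge>k\<^sub>0.
           (\<forall>\<^sub>F n in sequentially. K * real n \<le> real (d n)) \<longrightarrow>
           no_fast_slc_approximation \<alpha> l1_dist \<gamma> d (\<lambda>n. k)"
proof (intro exI[of _ "1::real"] exI[of _ "4::nat"] conjI ballI allI impI)
  fix \<alpha> :: real and d :: "nat \<Rightarrow> nat" and k :: nat
  assume "\<alpha> \<in> {0<..<1}" "4 \<le> k" "\<forall>\<^sub>F n in sequentially. 1 * real n \<le> real (d n)"
  then show "no_fast_slc_approximation \<alpha> l1_dist \<gamma> d (\<lambda>n. k)"
    using assms by (intro no_fast_slc_approximation_if_gadget[where \<gamma>' = 3] soft_O_const eventually_gadget_l1) auto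
qed simp

lemma no_fast_slc_approximation_l2:
  assumes "\<And>\<alpha>. \<alpha> \<in> {0<..<1} \<Longrightarrow> connectivity_hard \<alpha>" "\<gamma> \<le> sqrt (7/2)"
  shows "\<exists>K>0. \<forall>\<alpha>\<in>{0<..<1}. \<forall>\<epsilon>>0. \<forall>(d::nat \<Rightarrow> nat) (k::nat \<Rightarrow> nat).
           (\<forall>\<^sub>F n in sequentially. K * ln (real n) / \<epsilon>\<^sup>2 \<le> real (k n) \<and> k n \<le> d n) \<and>
           soft_O (\<lambda>n. real (k n)) (\<lambda>n. 1) \<longrightarrow>
           no_fast_slc_approximation \<alpha> l2_dist (\<gamma> - \<epsilon>) d k"
proof (intro exI[of _ "4000::real"] conjI ballI allI impI)
  fix \<alpha> \<epsilon> :: real and d k :: "nat \<Rightarrow> nat"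
  assume \<alpha>: "\<alpha> \<in> {0<..<1}" and \<epsilon>: "0 < \<epsilon>" and "(\<forall>\<^sub>F n in sequentially. 4000 * ln (real n) / \<epsilon>\<^sup>2 \<le> real (k n) \<and> k n \<le> d n) \<and>
           soft_O (\<lambda>n. real (k n)) (\<lambda>n. 1)"
  then have dim: "\<forall>\<^sub>F n in sequentially. 4000 * ln (real n) / \<epsilon>\<^sup>2 \<le> real (k n) \<and> k n \<le> d n"
    and k: "soft_O (\<lambda>n. real (k n)) (\<lambda>n. 1)" by blast+
  show "no_fast_slc_approximation \<alpha> l2_dist (\<gamma> - \<epsilon>) d k"
  proof (cases "\<epsilon> \<le> 1")
    case True
    show ?thesis
      by (rule no_fast_slc_approximation_if_gadget[OF assms(1)[OF \<alpha>] _ k eventually_gadget_l2[OF dim \<epsilon> True]])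
         (use \<alpha> \<epsilon> assms(2) in auto)
  next
    case False
    \<comment> \<open>For \<open>\<epsilon> > 1\<close> the target factor drops below 1, and no
      \<open>\<beta>\<close> with \<open>1 \<le> \<beta>\<close> lies under it.\<close>
    have "sqrt (7/2) \<le> 2"
      by (rule real_le_lsqrt) auto
    with False assms(2) have "\<gamma> - \<epsilon> < 1" by linarith
    then have "\<not> (1 \<le> x \<and> x < \<gamma> - \<epsilon>)" for x by linarith
    then show ?thesis
      unfolding no_fast_slc_approximation_def by blast
  qed
qed simp

theorem theorem4:
  shows
    "(one_cycle_vs_two_cycles_conjecture \<longrightarrow>
        (\<exists>K>0. \<forall>\<alpha>\<in>{0<..<1}. \<forall>\<epsilon>>0. \<forall>(d::nat \<Rightarrow> nat) (k::nat \<Rightarrow> nat).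
           (\<forall>\<^sub>F n in sequentially. K * ln (real n) / \<epsilon>\<^sup>2 \<le> real (k n) \<and> k n \<le> d n) \<and>
           soft_O (\<lambda>n. real (k n)) (\<lambda>n. 1) \<longrightarrow>
           no_fast_slc_approximation \<alpha> l2_dist (sqrt (2 + sqrt 2) - \<epsilon>) d k)) \<and>
     (one_cycle_vs_two_cycles_conjecture \<longrightarrow>
        (\<exists>K>0. \<exists>k\<^sub>0::nat. \<forall>\<alpha>\<in>{0<..<1}. \<forall>(d::nat \<Rightarrow> nat). \<forall>k\<ge>k\<^sub>0.
           (\<forall>\<^sub>F n in sequentially. K * real n \<le> real (d n)) \<longrightarrow>
           no_fast_slc_approximation \<alpha> l1_dist 3 d (\<lambda>n. k))) \<and>
     (sparse_connectivity_conjecture \<longrightarrow>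
        (\<exists>K>0. \<forall>\<alpha>\<in>{0<..<1}. \<forall>\<epsilon>>0. \<forall>(d::nat \<Rightarrow> nat) (k::nat \<Rightarrow> nat).
           (\<forall>\<^sub>F n in sequentially. K * ln (real n) / \<epsilon>\<^sup>2 \<le> real (k n) \<and> k n \<le> d n) \<and>
           soft_O (\<lambda>n. real (k n)) (\<lambda>n. 1) \<longrightarrow>
           no_fast_slc_approximation \<alpha> l2_dist (sqrt 2 - \<epsilon>) d k)) \<and>
     (sparse_connectivity_conjecture \<longrightarrow>
        (\<exists>K>0. \<exists>k\<^sub>0::nat. \<forall>\<alpha>\<in>{0<..<1}. \<forall>(d::nat \<Rightarrow> nat). \<forall>k\<ge>k\<^sub>0.
           (\<forall>\<^sub>F n in sequentially. K * real n \<le> real (d n)) \<longrightarrow>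
           no_fast_slc_approximation \<alpha> l1_dist 2 d (\<lambda>n. k)))"
proof (intro conjI impI no_fast_slc_approximation_l1 no_fast_slc_approximation_l2)
  \<comment> \<open>This places 2 + sqrt 2 below the squared gap 7/2 of the sign vector gadget; the
    other three factors are immediate.\<close>
  have "sqrt 2 \<le> 3/2"
    by (rule real_le_lsqrt) (auto simp: power2_eq_square)
  then show "sqrt (2 + sqrt 2) \<le> sqrt (7/2)"
    by simp
qed (auto intro: connectivity_hard_sparse connectivity_hard_cycle)

end
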